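(* Let $\alpha\in(0,1)$, $\rho,\mu,\lambda>0$ and $0<\beta<\alpha$, and let $\{\mathcal{G}(t)\}_{t\ge 0}$, $\mathcal{G}(t)=N_\beta(M(t),\lambda)$, be the generalized fractional negative binomial process with these parameters. Put $q=\frac{\lambda}{\Gamma(1+\beta)}$ and $d=\beta q^2B(\beta,1+\beta)$. Then for $0<s\le t<\infty$: (i) $\mathbb{E}[\mathcal{G}(t)]=q\,\mathbb{E}[M(t)^{\beta}]$, and, as $t\to\infty$, $$\mathbb{E}[\mathcal{G}(t)]\sim \frac{q\,\Gamma(1-\frac{\beta}{\alpha})}{\mu^{\beta/\alpha}\,\Gamma(1-\beta)}(\rho t)^{\beta/\alpha}.$$ (ii) $\operatorname{Var}[\mathcal{G}(t)]=q\,\mathbb{E}[M(t)^{\beta}]-q^2\left(\mathbb{E}[M(t)^{\beta}]\right)^2+2d\,\mathbb{E}[M(t)^{2\beta}]$. (iii) $$\operatorname{Cov}[\mathcal{G}(s),\mathcal{G}(t)]=q\,\mathbb{E}[M(s)^{\beta}]+d\,\mathbb{E}[M(s)^{2\beta}]-q^2\,\mathbb{E}[M(s)^{\beta}]\,\mathbb{E}[M(t)^{\beta}]+q^2\beta\,\mathbb{E}\left[M(t)^{2\beta}B\left(\beta,1+\beta;\frac{M(s)}{M(t)}\right)\right].$$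
   Context: Fractional Poisson process (FPP): for $0<\beta<1$, let $\{S_\beta(t)\}_{t\ge0}$ be the $\beta$-stable subordinator with $\mathbb{E}[e^{-uS_\beta(t)}]=e^{-tu^\beta}$, and let $E_\beta(t)=\inf\{r\ge 0: S_\beta(r)>t\}$ be its inverse. The FPP with parameter $\lambda>0$ is $N_\beta(t,\lambda)=N(E_\beta(t),\lambda)$, where $\{N(t,\lambda)\}_{t\ge0}$ is a homogeneous Poisson process of rate $\lambda$ independent of $E_\beta$. Mittag-Leffler (ML) Lévy subordinator: for $\alpha\in(0,1)$ and $\rho,\mu>0$, $M(t)=M_{\alpha,\rho,\mu}(t)$ is the non-decreasing Lévy process with $M(0)=0$ and $\mathbb{E}[e^{-uM(t)}]=\left(\frac{\mu}{\mu+u^\alpha}\right)^{\rho t}$, $u\ge 0$. Generalized fractional negative binomial process (GFNBP): $\mathcal{G}(t)=\mathcal{G}_{\alpha,\rho}^{\mu,\beta}(t,\lambda):=N_\beta(M_{\alpha,\rho,\mu}(t),\lambda)$, $t\ge 0$, where $M$ is independent of $N_\beta$. $B(a,b)=\Gamma(a)\Gamma(b)/\Gamma(a+b)$ is the beta function and $B(a,b;x)=\int_0^x v^{a-1}(1-v)^{b-1}\,dv$ is the incomplete beta function (with $B(a,b;1)=B(a,b)$). The notation $f(t)\sim g(t)$ means $f(t)/g(t)\to1$. *)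

theory Defs
  imports "HOL-Probability.Probability" "HOL-Library.Landau_Symbols"
begin

text \<open>Processes are indexed by time in \<open>{0..}\<close>; values at negative times are irrelevant.
  Path properties are required for every outcome, i.e. processes are given in their regular version.\<close>

definition independent_increments :: "'a measure \<Rightarrow> (real \<Rightarrow> 'a \<Rightarrow> real) \<Rightarrow> bool" where
  "independent_increments P X \<longleftrightarrow>
     (\<forall>n (\<tau> :: nat \<Rightarrow> real). 0 \<le> \<tau> 0 \<and> (\<forall>i<n. \<tau> i \<le> \<tau> (Suc i)) \<longrightarrow>
        prob_space.indep_vars P (\<lambda>_. borel) (\<lambda>i \<omega>. X (\<tau> (Suc i)) \<omega> - X (\<tau> i) \<omega>) {..<n})"

definition stationary_increments :: "'a measure \<Rightarrow> (real \<Rightarrow> 'a \<Rightarrow> real) \<Rightarrow> bool" where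
  "stationary_increments P X \<longleftrightarrow>
     (\<forall>s\<ge>0. \<forall>h\<ge>0. distr P borel (\<lambda>\<omega>. X (s + h) \<omega> - X s \<omega>)
                   = distr P borel (\<lambda>\<omega>. X h \<omega> - X 0 \<omega>))"

definition cadlag_path :: "(real \<Rightarrow> real) \<Rightarrow> bool" where
  "cadlag_path x \<longleftrightarrow>
     (\<forall>t\<ge>0. continuous (at_right t) x) \<and> (\<forall>t>0. \<exists>l. (x \<longlongrightarrow> l) (at_left t))"

definition levy_process :: "'a measure \<Rightarrow> (real \<Rightarrow> 'a \<Rightarrow> real) \<Rightarrow> bool" where
  "levy_process P X \<longleftrightarrow>
     (\<forall>t\<ge>0. X t \<in> borel_measurable P) \<and>
     (\<forall>\<omega>\<in>space P. X 0 \<omega> = 0) \<and>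
     independent_increments P X \<and>
     stationary_increments P X \<and>
     (\<forall>\<omega>\<in>space P. cadlag_path (\<lambda>t. X t \<omega>))"

definition subordinator :: "'a measure \<Rightarrow> (real \<Rightarrow> 'a \<Rightarrow> real) \<Rightarrow> bool" where
  "subordinator P X \<longleftrightarrow>
     levy_process P X \<and> (\<forall>\<omega>\<in>space P. mono_on {0..} (\<lambda>t. X t \<omega>))"

definition stable_subordinator :: "'a measure \<Rightarrow> real \<Rightarrow> (real \<Rightarrow> 'a \<Rightarrow> real) \<Rightarrow> bool" where
  "stable_subordinator P \<beta> S \<longleftrightarrow>
     subordinator P S \<and>
     (\<forall>t\<ge>0. \<forall>u\<ge>0. prob_space.expectation P (\<lambda>\<omega>. exp (- u * S t \<omega>)) = exp (- t * u powr \<beta>))"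

definition mittag_leffler_subordinator ::
  "'a measure \<Rightarrow> real \<Rightarrow> real \<Rightarrow> real \<Rightarrow> (real \<Rightarrow> 'a \<Rightarrow> real) \<Rightarrow> bool" where
  "mittag_leffler_subordinator P \<alpha> \<rho> \<mu> M \<longleftrightarrow>
     subordinator P M \<and>
     (\<forall>t\<ge>0. \<forall>u\<ge>0. prob_space.expectation P (\<lambda>\<omega>. exp (- u * M t \<omega>))
                   = (\<mu> / (\<mu> + u powr \<alpha>)) powr (\<rho> * t))"

definition poisson_process :: "'a measure \<Rightarrow> real \<Rightarrow> (real \<Rightarrow> 'a \<Rightarrow> nat) \<Rightarrow> bool" where
  "poisson_process P lam N \<longleftrightarrow>
     (\<forall>t\<ge>0. N t \<in> borel_measurable P) \<and>
     (\<forall>\<omega>\<in>space P. N 0 \<omega> = 0 \<and> mono_on {0..} (\<lambda>t. N t \<omega>) \<and>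
        cadlag_path (\<lambda>t. real (N t \<omega>))) \<and>
     independent_increments P (\<lambda>t \<omega>. real (N t \<omega>)) \<and>
     (\<forall>s\<ge>0. \<forall>t\<ge>s. \<forall>k. prob_space.prob P {\<omega> \<in> space P. N t \<omega> - N s \<omega> = k}
        = exp (- lam * (t - s)) * (lam * (t - s)) ^ k / fact k)"

text \<open>The set below is almost surely nonempty for a stable subordinator; on the null event where
  it is empty, \<open>Inf {}\<close> is an arbitrary fixed real.\<close>

definition inverse_process :: "(real \<Rightarrow> 'a \<Rightarrow> real) \<Rightarrow> real \<Rightarrow> 'a \<Rightarrow> real" where
  "inverse_process S t \<omega> = Inf {r. 0 \<le> r \<and> S r \<omega> > t}"

definition fractional_poisson ::
  "(real \<Rightarrow> 'a \<Rightarrow> nat) \<Rightarrow> (real \<Rightarrow> 'a \<Rightarrow> real) \<Rightarrow> real \<Rightarrow> 'a \<Rightarrow> nat" where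
  "fractional_poisson N S t \<omega> = N (inverse_process S t \<omega>) \<omega>"

definition gfnbp :: "(real \<Rightarrow> 'a \<Rightarrow> nat) \<Rightarrow> (real \<Rightarrow> 'a \<Rightarrow> real) \<Rightarrow> (real \<Rightarrow> 'a \<Rightarrow> real)
    \<Rightarrow> real \<Rightarrow> 'a \<Rightarrow> nat" where
  "gfnbp N S M t \<omega> = fractional_poisson N S (M t \<omega>) \<omega>"

definition independent_processes :: "'a measure \<Rightarrow> (real \<Rightarrow> 'a \<Rightarrow> real)
    \<Rightarrow> (real \<Rightarrow> 'a \<Rightarrow> real) \<Rightarrow> bool" where
  "independent_processes P X Y \<longleftrightarrow>
     prob_space.indep_var P
       (Pi\<^sub>M {0..} (\<lambda>_. borel)) (\<lambda>\<omega>. \<lambda>t\<in>{0..}. X t \<omega>)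
       (Pi\<^sub>M {0..} (\<lambda>_. borel)) (\<lambda>\<omega>. \<lambda>t\<in>{0..}. Y t \<omega>)"

text \<open>Expectation with values in the extended reals. It is needed because
  \<open>E[M(t) powr (2 * \<beta>)]\<close> is infinite when \<open>2 * \<beta> \<ge> \<alpha>\<close>, where the Bochner integral would be \<open>0\<close>.
  On \<open>ereal\<close> we have \<open>\<infinity> - \<infinity> = \<infinity>\<close>, so the value is only meaningful when the negative
  (or positive) part has finite integral; see \<open>ext_covariance_well_defined\<close>.\<close>

definition ext_expectation :: "'a measure \<Rightarrow> ('a \<Rightarrow> real) \<Rightarrow> ereal" where
  "ext_expectation P X =
     enn2ereal (\<integral>\<^sup>+\<omega>. ennreal (X \<omega>) \<partial>P) - enn2ereal (\<integral>\<^sup>+\<omega>. ennreal (- X \<omega>) \<partial>P)"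

definition ext_covariance :: "'a measure \<Rightarrow> ('a \<Rightarrow> real) \<Rightarrow> ('a \<Rightarrow> real) \<Rightarrow> ereal" where
  "ext_covariance P X Y =
     ext_expectation P (\<lambda>\<omega>. (X \<omega> - prob_space.expectation P X) * (Y \<omega> - prob_space.expectation P Y))"

definition ext_variance :: "'a measure \<Rightarrow> ('a \<Rightarrow> real) \<Rightarrow> ereal" where
  "ext_variance P X = ext_expectation P (\<lambda>\<omega>. (X \<omega> - prob_space.expectation P X)\<^sup>2)"

lemma ext_expectation_integrable:
  assumes "integrable P X"
  shows "ext_expectation P X = ereal (integral\<^sup>L P X)"
proof -
  have "(\<integral>\<^sup>+\<omega>. ennreal (X \<omega>) \<partial>P) < \<infinity>" "(\<integral>\<^sup>+\<omega>. ennreal (- X \<omega>) \<partial>P) < \<infinity>"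
    using assms by (auto simp: real_integrable_def top.not_eq_extremum)
  then show ?thesis
    unfolding ext_expectation_def real_lebesgue_integral_def[OF assms]
    by (cases "\<integral>\<^sup>+\<omega>. ennreal (X \<omega>) \<partial>P"; cases "\<integral>\<^sup>+\<omega>. ennreal (- X \<omega>) \<partial>P") auto
qed

lemma ext_covariance_well_defined:
  assumes P: "prob_space P" and X: "integrable P X" and Y: "integrable P Y"
    and "\<And>\<omega>. X \<omega> \<ge> 0" "\<And>\<omega>. Y \<omega> \<ge> 0"
  shows "(\<integral>\<^sup>+\<omega>. ennreal (- ((X \<omega> - integral\<^sup>L P X) * (Y \<omega> - integral\<^sup>L P Y))) \<partial>P) < \<infinity>"
proof -
  interpret prob_space P by (rule P)
  let ?a = "integral\<^sup>L P X" and ?b = "integral\<^sup>L P Y"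
  have ab: "?a \<ge> 0" "?b \<ge> 0" using assms by auto
  have "- ((X \<omega> - ?a) * (Y \<omega> - ?b)) \<le> ?b * X \<omega> + ?a * Y \<omega>" for \<omega>
  proof -
    have "0 \<le> X \<omega> * Y \<omega>" "0 \<le> ?a * ?b" using assms ab by auto
    then show ?thesis by (simp add: algebra_simps)
  qed
  then have "(\<integral>\<^sup>+\<omega>. ennreal (- ((X \<omega> - ?a) * (Y \<omega> - ?b))) \<partial>P)
      \<le> (\<integral>\<^sup>+\<omega>. ennreal (?b * X \<omega> + ?a * Y \<omega>) \<partial>P)"
    by (intro nn_integral_mono ennreal_leI) auto
  also have "\<dots> < \<infinity>"
  proof -
    have "integrable P (\<lambda>\<omega>. ?b * X \<omega> + ?a * Y \<omega>)" using X Y by auto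
    then show ?thesis by (auto simp: real_integrable_def top.not_eq_extremum)
  qed
  finally show ?thesis .
qed

definition incomplete_Beta :: "real \<Rightarrow> real \<Rightarrow> real \<Rightarrow> real" where
  "incomplete_Beta a b x = (LINT v:{0..x}|lborel. v powr (a - 1) * (1 - v) powr (b - 1))"

end

theory Submission
  imports Defs
begin

text \<open>The process is \<open>G(t) = N(E\<^sub>\<beta>(M(t)))\<close> with three layers: a Poisson process \<open>N\<close>, the
inverse \<open>E\<^sub>\<beta>\<close> of a stable subordinator \<open>S\<close>, and a Mittag-Leffler subordinator \<open>M\<close>.
A path of \<open>N\<close>, and also a path of \<open>N \<circ> E\<^sub>\<beta>\<close>, is right-continuous, hence determined by its
values on a countable grid. This makes evaluation at a random time measurable, and for an
independent random time it lets the moments be computed by first freezing the time and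
averaging over the path (\<open>nn_integral_independent_composition\<close>). So the three layers can be
averaged out one after the other.

\<^item> Poisson layer: \<open>E[N(x)] = \<lambda>x\<close> and, as increments are independent,
  \<open>E[N(x)N(y)] = \<lambda>x + \<lambda>\<^sup>2xy\<close> for \<open>x \<le> y\<close> (\<open>poisson_process_moments\<close>).

\<^item> Inverse stable layer: \<open>E\<^sub>\<beta>(a)\<close> is the time that \<open>S\<close> spends in \<open>[0, a]\<close>. Its moments are
  therefore governed by the potential measure \<open>A \<mapsto> \<integral> P(S(r) \<in> A) dr\<close>, whose Laplace transform is
  \<open>\<integral> exp(-r u\<^sup>\<beta>) dr = u\<^sup>-\<^sup>\<beta>\<close>; so this measure has density \<open>x\<^sup>\<beta>\<^sup>-\<^sup>1/\<Gamma>(\<beta>)\<close>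
  (\<open>stable_potential_measure\<close>). Its mass on \<open>[0, a]\<close> is \<open>E[E\<^sub>\<beta>(a)]\<close>. For \<open>E[E\<^sub>\<beta>(a)E\<^sub>\<beta>(b)]\<close>, the
  double time integral is split according to which of the two times is smaller; the Markov
  property turns each half into an iterated integral of the potential density, which is the
  (incomplete) beta integral (\<open>inverse_stable_moments\<close>).

\<^item> Mittag-Leffler layer: it only enters through \<open>E[M(t)\<^sup>\<beta>]\<close>, \<open>E[M(t)\<^sup>2\<^sup>\<beta>]\<close> and the expectation of
  the incomplete beta term. For the asymptotics, \<open>x\<^sup>\<beta>\<close> is a mixture of the functions
  \<open>1 - exp(-ux)\<close>, so \<open>E[M(t)\<^sup>\<beta>]\<close> is an integral of \<open>1 - (\<mu>/(\<mu> + u\<^sup>\<alpha>))\<^sup>\<rho>\<^sup>t\<close>; after rescaling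
  \<open>u = t\<^sup>-\<^sup>1\<^sup>/\<^sup>\<alpha>v\<close> the integrand increases to that of an \<open>\<alpha>\<close>-stable law, and dominated
  convergence gives the limit (\<open>mittag_leffler_fractional_moment\<close>).

All second moments are computed as integrals of nonnegative functions with values in
\<open>[0, \<infinity>]\<close>, because \<open>E[M(t)\<^sup>2\<^sup>\<beta>]\<close> is infinite when \<open>2\<beta> \<ge> \<alpha>\<close>; the subtraction of the product of the
means, which are finite, comes last (\<open>ext_covariance_nonneg\<close>).\<close>

section \<open>Gamma-type integrals\<close>

text \<open>The substitution \<open>w = y u\<^sup>a\<close> turns the integral into Euler's integral for \<open>\<Gamma>(s)\<close>.\<close>

lemma nn_integral_Gamma_powr:
  fixes s a y :: real
  assumes s: "s > 0" and a: "a > 0" and y: "y > 0"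
  shows "(\<integral>\<^sup>+u\<in>{0<..}. ennreal (u powr (a * s - 1) * exp (- y * u powr a)) \<partial>lborel)
           = ennreal (Gamma s / (a * y powr s))"
proof -
  define f g g' where "f w = w powr (s - 1) / exp w" and "g u = y * u powr a"
    and "g' u = y * (a * u powr (a - 1))" for w u :: real
  have "(f has_integral Gamma s) {0..}"
    using Gamma_integral_real[OF s] by (simp add: f_def[abs_def])
  then have f_int: "(f has_integral Gamma s) {0<..}"
  proof (subst has_integral_spike_set_eq[of _ "{0..}"])
    have "{x \<in> {0<..} - {0..}. f x \<noteq> 0} = {}" "{x \<in> {0..} - {0<..}. f x \<noteq> 0} = {}"
      by (auto simp: f_def order.order_iff_strict)
    then show "negligible {x \<in> {0<..} - {0..}. f x \<noteq> 0}" "negligible {x \<in> {0..} - {0<..}. f x \<noteq> 0}"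
      by (simp_all only: negligible_empty)
  qed
  have img: "g ` {0<..} = {0<..}"
  proof (intro equalityI subsetI)
    fix w :: real assume w: "w \<in> {0<..}"
    have "w = g ((w / y) powr (1 / a))"
      using w a y by (simp add: g_def powr_powr)
    then show "w \<in> g ` {0<..}"
      using w y by (intro image_eqI[of _ _ "(w / y) powr (1 / a)"]) auto
  qed (use y in \<open>auto simp: g_def\<close>)
  have inj: "inj_on g {0<..}"
  proof (rule inj_onI)
    fix u v :: real assume uv: "u \<in> {0<..}" "v \<in> {0<..}" "g u = g v"
    then have "(u powr a) powr (1 / a) = (v powr a) powr (1 / a)"
      using y by (simp add: g_def)
    then show "u = v" using uv a by (simp add: powr_powr)
  qed
  have der: "(g has_field_derivative g' x) (at x within {0<..})" if "x \<in> {0<..}" for x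
    using that unfolding g_def[abs_def] g'_def
    by (auto intro!: derivative_eq_intros)
  have "f absolutely_integrable_on g ` {0<..} \<and> integral (g ` {0<..}) f = Gamma s"
    unfolding img using f_int
    by (auto intro!: nonnegative_absolutely_integrable_1 simp: f_def has_integral_iff)
  then have *: "(\<lambda>x. \<bar>g' x\<bar> * f (g x)) absolutely_integrable_on {0<..} \<and>
      integral {0<..} (\<lambda>x. \<bar>g' x\<bar> * f (g x)) = Gamma s"
    by (subst has_absolute_integral_change_of_variables_1'[OF _ der inj]) auto
  have "((\<lambda>x. \<bar>g' x\<bar> * f (g x)) has_integral Gamma s) {0<..}"
    using * set_lebesgue_integral_eq_integral(1)[of "{0<..}" "\<lambda>x. \<bar>g' x\<bar> * f (g x)"]
    by (simp add: has_integral_iff)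
  then have "(\<integral>\<^sup>+u\<in>{0<..}. ennreal (\<bar>g' u\<bar> * f (g u)) \<partial>lborel) = ennreal (Gamma s)"
    by (intro nn_integral_has_integral_lebesgue') (auto simp: f_def)
  also have "(\<integral>\<^sup>+u\<in>{0<..}. ennreal (\<bar>g' u\<bar> * f (g u)) \<partial>lborel)
      = (\<integral>\<^sup>+u. ennreal (a * y powr s) * (ennreal (u powr (a * s - 1) * exp (- y * u powr a)) * indicator {0<..} u) \<partial>lborel)"
  proof (rule nn_integral_cong)
    fix u :: real
    show "ennreal (\<bar>g' u\<bar> * f (g u)) * indicator {0<..} u =
      ennreal (a * y powr s) * (ennreal (u powr (a * s - 1) * exp (- y * u powr a)) * indicator {0<..} u)"
    proof (cases "u > 0")
      case True
      have "u powr (a - 1) * u powr (a * (s - 1)) = u powr (a * s - 1)"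
        by (simp add: powr_add[symmetric] algebra_simps)
      moreover have "y * y powr (s - 1) = y powr s"
        using y powr_add[of y 1 "s - 1"] by simp
      moreover have "\<bar>g' u\<bar> * f (g u)
          = a * (y * y powr (s - 1)) * (u powr (a - 1) * u powr (a * (s - 1))) * exp (- y * u powr a)"
        using True y a by (simp add: g'_def f_def g_def powr_mult powr_powr exp_minus field_simps)
      ultimately have "\<bar>g' u\<bar> * f (g u) = (a * y powr s) * (u powr (a * s - 1) * exp (- y * u powr a))"
        by simp
      then show ?thesis using True a y by (simp add: ennreal_mult')
    qed simp
  qed
  also have "\<dots> = ennreal (a * y powr s) *
      (\<integral>\<^sup>+u\<in>{0<..}. ennreal (u powr (a * s - 1) * exp (- y * u powr a)) \<partial>lborel)"
    by (rule nn_integral_cmult) measurable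
  finally have "ennreal (Gamma s) = ennreal (a * y powr s) *
      (\<integral>\<^sup>+u\<in>{0<..}. ennreal (u powr (a * s - 1) * exp (- y * u powr a)) \<partial>lborel)" (is "_ = _ * ?I") ..
  then have "?I = ennreal (Gamma s) / ennreal (a * y powr s)"
    using a y mult_divide_eq_ennreal[of "ennreal (a * y powr s)" ?I]
    by (simp only: mult.commute[of _ ?I]) (simp add: mult_le_0_iff)
  then show ?thesis using a y Gamma_real_pos[OF s] by (simp add: divide_ennreal)
qed

lemma nn_integral_powr_from_0:
  fixes a c :: real
  assumes "a > 0" "c \<ge> 0"
  shows "(\<integral>\<^sup>+x\<in>{0..c}. ennreal (x powr (a - 1)) \<partial>lborel) = ennreal (c powr a / a)"
  using nn_integral_has_integral_lebesgue'[OF _ has_integral_powr_from_0[of "a - 1" c]] assms by simp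

text \<open>This represents \<open>x\<^sup>b\<^sup>/\<^sup>a\<close> as a mixture of the functions \<open>1 - exp(-x u\<^sup>a)\<close>. It follows by writing
\<open>1 - exp(-xv)\<close> as the integral of \<open>v exp(-yv)\<close> over \<open>y \<in> [0, x]\<close> and integrating over \<open>u\<close> first.
With \<open>a = 1\<close> it converts Laplace transforms into fractional moments; with \<open>a = \<alpha>\<close> it evaluates the
limit that occurs in the asymptotics of the mean.\<close>

lemma nn_integral_one_minus_exp_powr:
  fixes a b x :: real
  assumes b: "0 < b" and ba: "b < a" and x: "x \<ge> 0"
  shows "(\<integral>\<^sup>+u\<in>{0<..}. ennreal ((1 - exp (- x * u powr a)) * u powr (- b - 1)) \<partial>lborel)
           = ennreal (Gamma (1 - b / a) / b * x powr (b / a))"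
proof -
  define c where "c = 1 - b / a"
  have c: "0 < c" "c < 1" and a: "a > 0" using b ba by (auto simp: c_def field_simps)
  have inner: "(\<integral>\<^sup>+y\<in>{0..x}. ennreal (v * exp (- y * v)) \<partial>lborel) = ennreal (1 - exp (- x * v))"
    if v: "v > 0" for v :: real
  proof -
    have "(\<integral>\<^sup>+y. ennreal (v * exp (- y * v)) * indicator {0..x} y \<partial>lborel)
        = ennreal ((- exp (- x * v)) - (- exp (- 0 * v)))"
      by (rule nn_integral_FTC_Icc) (use v x in \<open>auto intro!: derivative_eq_intros simp: mult.commute\<close>)
    then show ?thesis by simp
  qed
  have "(\<integral>\<^sup>+u\<in>{0<..}. ennreal ((1 - exp (- x * u powr a)) * u powr (- b - 1)) \<partial>lborel)
      = (\<integral>\<^sup>+u. (\<integral>\<^sup>+y. ennreal (u powr (a * c - 1) * exp (- y * u powr a)) * indicator {0<..} u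
            * indicator {0..x} y \<partial>lborel) \<partial>lborel)"
  proof (rule nn_integral_cong)
    fix u :: real
    show "ennreal ((1 - exp (- x * u powr a)) * u powr (- b - 1)) * indicator {0<..} u =
       (\<integral>\<^sup>+y. ennreal (u powr (a * c - 1) * exp (- y * u powr a)) * indicator {0<..} u
            * indicator {0..x} y \<partial>lborel)"
    proof (cases "u > 0")
      case True
      have "ennreal ((1 - exp (- x * u powr a)) * u powr (- b - 1))
          = (\<integral>\<^sup>+y\<in>{0..x}. ennreal (u powr a * exp (- y * u powr a)) \<partial>lborel) * ennreal (u powr (- b - 1))"
        using True x by (subst inner) (auto simp: ennreal_mult)
      also have "\<dots> = (\<integral>\<^sup>+y. ennreal (u powr a * exp (- y * u powr a)) * indicator {0..x} y
           * ennreal (u powr (- b - 1)) \<partial>lborel)"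
        by (rule nn_integral_multc[symmetric]) measurable
      also have "\<dots> = (\<integral>\<^sup>+y. ennreal (u powr (a * c - 1) * exp (- y * u powr a))
            * indicator {0..x} y \<partial>lborel)"
      proof (rule nn_integral_cong)
        fix y :: real
        have e: "a + (- b - 1) = a * c - 1" using a by (simp add: c_def field_simps)
        have "u powr a * exp (- y * u powr a) * u powr (- b - 1) = u powr (a * c - 1) * exp (- y * u powr a)"
          unfolding e[symmetric] powr_add by simp
        then show "ennreal (u powr a * exp (- y * u powr a)) * indicator {0..x} y * ennreal (u powr (- b - 1))
          = ennreal (u powr (a * c - 1) * exp (- y * u powr a)) * indicator {0..x} y"
          by (auto simp: indicator_def ennreal_mult[symmetric])
      qed
      finally show ?thesis using True by simp
    qed simp
  qed
  also have "\<dots> = (\<integral>\<^sup>+y. (\<integral>\<^sup>+u. ennreal (u powr (a * c - 1) * exp (- y * u powr a)) * indicator {0<..} u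
            * indicator {0..x} y \<partial>lborel) \<partial>lborel)"
    by (rule lborel_pair.Fubini') measurable
  also have "\<dots> = (\<integral>\<^sup>+y. ennreal (Gamma c / a) * (ennreal (y powr (b / a - 1)) * indicator {0..x} y) \<partial>lborel)"
  proof (rule nn_integral_cong_AE)
    have "AE y in lborel. y \<noteq> (0::real)" by (rule AE_lborel_singleton)
    then show "AE y in lborel. (\<integral>\<^sup>+u. ennreal (u powr (a * c - 1) * exp (- y * u powr a)) * indicator {0<..} u
            * indicator {0..x} y \<partial>lborel) = ennreal (Gamma c / a) * (ennreal (y powr (b / a - 1)) * indicator {0..x} y)"
    proof eventually_elim
      case (elim y)
      show ?case
      proof (cases "y \<in> {0..x}")
        case True
        then have y: "y > 0" using elim by auto
        have "Gamma c / (a * y powr c) = Gamma c / a * y powr (b / a - 1)"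
          using powr_minus[of y c] by (simp add: c_def field_simps)
        then show ?thesis using True c a nn_integral_Gamma_powr[OF c(1) a y]
          by (simp add: ennreal_mult[symmetric])
      qed simp
    qed
  qed
  also have "\<dots> = ennreal (Gamma c / a) * ennreal (x powr (b / a) / (b / a))"
    using a b x by (subst nn_integral_cmult) (simp_all add: nn_integral_powr_from_0)
  also have "\<dots> = ennreal (Gamma (1 - b / a) / b * x powr (b / a))"
    using a b c by (simp add: ennreal_mult[symmetric] c_def)
  finally show ?thesis .
qed

text \<open>With \<open>c = u\<^sup>\<beta>\<close> this is the Laplace transform of the potential measure of a stable subordinator.\<close>

lemma nn_integral_exp_times_Ici:
  assumes "c > (0::real)"
  shows "(\<integral>\<^sup>+r\<in>{0..}. ennreal (exp (- r * c)) \<partial>lborel) = ennreal (1 / c)"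
proof -
  have "(\<integral>\<^sup>+r\<in>{0..}. ennreal (exp (- r * c)) \<partial>lborel)
      = ennreal (0 - (- exp (- 0 * c) / c))"
  proof (rule nn_integral_FTC_atLeast)
    have "filterlim (\<lambda>r. - (c * r)) at_bot at_top"
      using assms by (simp add: filterlim_uminus_at_bot filterlim_tendsto_pos_mult_at_top[OF tendsto_const _ filterlim_ident])
    then have "((\<lambda>r. exp (- (c * r))) \<longlongrightarrow> 0) at_top"
      by (rule filterlim_compose[OF exp_at_bot])
    from tendsto_mult_left[OF this, of "- (1 / c)"]
    show "((\<lambda>r. - exp (- r * c) / c) \<longlongrightarrow> 0) at_top"
      by (simp add: mult.commute)
  qed (use assms in \<open>auto intro!: derivative_eq_intros\<close>)
  then show ?thesis by simp
qed

section \<open>Uniqueness of Laplace transforms\<close>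

text \<open>On a bounded interval the exponential series may be integrated term by term, so the moments
determine the characteristic function.\<close>

lemma moments_determine_distribution_on_unit_interval:
  fixes M1 M2 :: "real measure"
  assumes "real_distribution M1" "real_distribution M2"
    and AE1: "AE x in M1. x \<in> {0..1}" and AE2: "AE x in M2. x \<in> {0..1}"
    and mom: "\<And>n::nat. (\<integral>x. x ^ n \<partial>M1) = (\<integral>x. x ^ n \<partial>M2)"
  shows "M1 = M2"
proof (rule Levy_uniqueness)
  have char_eq: "char M t = (\<Sum>n. ((\<i> * of_real t) ^ n /\<^sub>R fact n) * of_real (\<integral>x. x ^ n \<partial>M))"
    if "real_distribution M" and AE: "AE x in M. x \<in> {0..1}" for M :: "real measure" and t
  proof -
    interpret real_distribution M by (rule that(1))
    define f where "f n x = ((\<i> * of_real t) ^ n /\<^sub>R fact n) * of_real (x ^ n)" for n :: nat and x :: real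
    have bound: "AE x in M. \<bar>x ^ n\<bar> \<le> 1" for n :: nat
      using AE by eventually_elim (auto simp: power_le_one)
    have int: "integrable M (\<lambda>x. x ^ n)" for n :: nat
      using bound by (intro integrable_const_bound[of _ 1]) auto
    have norm_f: "norm (f n x) = \<bar>t\<bar> ^ n / fact n * \<bar>x ^ n\<bar>" for n x
      by (simp add: f_def norm_mult norm_power power_abs divide_inverse)
    have "char M t = (\<integral>x. (\<Sum>n. f n x) \<partial>M)"
      unfolding char_def f_def
      by (intro Bochner_Integration.integral_cong)
         (simp_all add: exp_def power_mult_distrib scaleR_conv_of_real mult_ac)
    also have "\<dots> = (\<Sum>n. \<integral>x. f n x \<partial>M)"
    proof (rule integral_suminf)
      show "integrable M (f n)" for n
        unfolding f_def using int by (intro integrable_mult_right integrable_of_real) auto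
      have sm: "summable (\<lambda>n. \<bar>t\<bar> ^ n / fact n)"
        using summable_exp[of "\<bar>t\<bar>"] by (simp add: divide_inverse mult.commute)
      show "AE x in M. summable (\<lambda>n. norm (f n x))"
        using AE
      proof eventually_elim
        case (elim x)
        show ?case
        proof (intro summable_comparison_test'[OF sm, of 0])
          fix n :: nat
          have "\<bar>x ^ n\<bar> \<le> 1" using elim by (simp add: power_le_one)
          then show "norm (norm (f n x)) \<le> \<bar>t\<bar> ^ n / fact n"
            using mult_left_mono[of "\<bar>x ^ n\<bar>" 1 "\<bar>t\<bar> ^ n / fact n"] by (simp add: norm_f)
        qed
      qed
      show "summable (\<lambda>n. \<integral>x. norm (f n x) \<partial>M)"
      proof (rule summable_comparison_test'[OF sm, of 0])
        fix n :: nat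
        have "(\<integral>x. \<bar>x ^ n\<bar> \<partial>M) \<le> (\<integral>x. 1 \<partial>M)"
          using bound int by (intro integral_mono_AE) auto
        then show "norm (\<integral>x. norm (f n x) \<partial>M) \<le> \<bar>t\<bar> ^ n / fact n"
          using mult_left_mono[of "\<integral>x. \<bar>x ^ n\<bar> \<partial>M" 1 "\<bar>t\<bar> ^ n / fact n"] prob_space
          by (simp add: norm_f abs_mult)
      qed
    qed
    also have "\<dots> = (\<Sum>n. ((\<i> * of_real t) ^ n /\<^sub>R fact n) * of_real (\<integral>x. x ^ n \<partial>M))"
      unfolding f_def by (simp del: of_real_power)
    finally show ?thesis .
  qed
  show "char M1 = char M2"
    using char_eq[OF assms(1,3)] char_eq[OF assms(2,4)] by (simp add: fun_eq_iff mom)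
qed (rule assms)+

text \<open>The measures may be infinite, as potential measures are. Tilting by \<open>exp(-x)/L(1)\<close> makes
them probability measures, and the map \<open>x \<mapsto> exp(-x)\<close> then sends them to distributions on the unit
interval whose \<open>n\<close>-th moments are \<open>L(n + 1)/L(1)\<close>. Both operations can be undone.\<close>

lemma Laplace_transform_determines_measure:
  fixes K1 K2 :: "real measure" and L :: "real \<Rightarrow> real"
  assumes sets: "sets K1 = sets borel" "sets K2 = sets borel"
    and pos: "AE x in K1. x \<ge> 0" "AE x in K2. x \<ge> 0"
    and L1: "\<And>u. u > 0 \<Longrightarrow> (\<integral>\<^sup>+x. ennreal (exp (- u * x)) \<partial>K1) = ennreal (L u)"
    and L2: "\<And>u. u > 0 \<Longrightarrow> (\<integral>\<^sup>+x. ennreal (exp (- u * x)) \<partial>K2) = ennreal (L u)"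
    and L: "L 1 > 0"
  shows "K1 = K2"
proof -
  define T where "T K = density K (\<lambda>x. ennreal (exp (- x) / L 1))" for K :: "real measure"
  define D where "D K = distr (T K) borel (\<lambda>x. exp (- x))" for K
  have props: "real_distribution (D K) \<and> (AE y in D K. y \<in> {0..1}) \<and>
      (\<forall>n. (\<integral>y. y ^ n \<partial>(D K)) = L (real (Suc n)) / L 1) \<and>
      K = density (distr (D K) borel (\<lambda>y. - ln y)) (\<lambda>x. ennreal (L 1 * exp x))"
    if s[measurable_cong, simp]: "sets K = sets borel" and p: "AE x in K. x \<ge> 0"
      and LK: "\<And>u. u > 0 \<Longrightarrow> (\<integral>\<^sup>+x. ennreal (exp (- u * x)) \<partial>K) = ennreal (L u)" for K :: "real measure"
  proof (intro conjI allI)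
    have nn: "(\<integral>\<^sup>+y. ennreal (y ^ n) \<partial>(D K)) = ennreal (L (real (Suc n)) / L 1)" for n
    proof -
      have "(\<integral>\<^sup>+y. ennreal (y ^ n) \<partial>(D K))
          = (\<integral>\<^sup>+x. ennreal (exp (- x) / L 1) * ennreal (exp (- x) ^ n) \<partial>K)"
        unfolding D_def T_def by (simp add: nn_integral_distr nn_integral_density)
      also have "\<dots> = (\<integral>\<^sup>+x. ennreal (1 / L 1) * ennreal (exp (- real (Suc n) * x)) \<partial>K)"
        using L by (intro nn_integral_cong)
          (simp add: ennreal_mult[symmetric] exp_of_nat_mult[symmetric] exp_add[symmetric] algebra_simps)
      also have "\<dots> = ennreal (1 / L 1) * ennreal (L (real (Suc n)))"
        by (subst nn_integral_cmult) (auto simp only: LK, measurable)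
      finally show ?thesis using L by (simp add: ennreal_mult'[symmetric])
    qed
    have "emeasure (D K) (space (D K)) = 1"
      using nn[of 0] L by simp
    then have "prob_space (D K)" by (rule prob_spaceI)
    then show "real_distribution (D K)"
      by (simp add: real_distribution_def real_distribution_axioms_def D_def)
    show AE: "AE y in D K. y \<in> {0..1}"
      unfolding D_def T_def using p
      by (auto simp: AE_distr_iff AE_density elim: AE_mp)
    show "(\<integral>y. y ^ n \<partial>(D K)) = L (real (Suc n)) / L 1" for n
    proof -
      have "L (real (Suc n)) \<ge> 0"
      \<comment> \<open>A negative value of \<open>L\<close> would be read as the integral \<open>0\<close>, hence force the null measure.\<close>
      proof (rule ccontr)
        assume "\<not> L (real (Suc n)) \<ge> 0"
        then have "(\<integral>\<^sup>+x. ennreal (exp (- real (Suc n) * x)) \<partial>K) = 0"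
          by (subst LK) (auto simp: ennreal_neg)
        then have "AE x in K. False" by (subst (asm) nn_integral_0_iff_AE) auto
        then have "(\<integral>\<^sup>+x. ennreal (exp (- 1 * x)) \<partial>K) = 0"
          by (subst nn_integral_0_iff_AE) auto
        then show False using LK[of 1] L by simp
      qed
      then show ?thesis
        using nn[of n] L AE
        by (intro integral_eq_nn_integral[THEN trans]) (auto simp: D_def elim!: eventually_mono)
    qed
    have "distr (D K) borel (\<lambda>y. - ln y) = distr (T K) borel (\<lambda>x. x)"
      unfolding D_def by (subst distr_distr) (auto simp: T_def comp_def)
    also have "\<dots> = T K" by (rule distr_id2) (simp add: T_def)
    finally have "density (distr (D K) borel (\<lambda>y. - ln y)) (\<lambda>x. ennreal (L 1 * exp x))
        = density K (\<lambda>x. ennreal (exp (- x) / L 1) * ennreal (L 1 * exp x))"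
      by (simp add: T_def density_density_eq)
    also have "\<dots> = density K (\<lambda>x. 1)"
      using L by (intro density_cong) (auto simp: ennreal_mult[symmetric] exp_minus)
    finally show "K = density (distr (D K) borel (\<lambda>y. - ln y)) (\<lambda>x. ennreal (L 1 * exp x))"
      by (simp add: density_1)
  qed
  note P1 = props[OF sets(1) pos(1) L1] and P2 = props[OF sets(2) pos(2) L2]
  have "D K1 = D K2"
    using P1 P2 by (intro moments_determine_distribution_on_unit_interval) auto
  then show ?thesis using P1 P2 by metis
qed

section \<open>Right-continuous processes at independent random times\<close>

lemma (in prob_space) nn_integral_indep_var:
  assumes ind: "indep_var A X B Y" and g[measurable]: "g \<in> borel_measurable (A \<Otimes>\<^sub>M B)"
  shows "(\<integral>\<^sup>+\<omega>. g (X \<omega>, Y \<omega>) \<partial>M) = (\<integral>\<^sup>+\<omega>. \<integral>\<^sup>+\<omega>'. g (X \<omega>, Y \<omega>') \<partial>M \<partial>M)"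
proof -
  have [measurable]: "random_variable A X" "random_variable B Y"
    and eq: "distr M A X \<Otimes>\<^sub>M distr M B Y = distr M (A \<Otimes>\<^sub>M B) (\<lambda>\<omega>. (X \<omega>, Y \<omega>))"
    using ind unfolding indep_var_distribution_eq by auto
  interpret Y: prob_space "distr M B Y" by (rule prob_space_distr) measurable
  have sections: "(\<integral>\<^sup>+y. g (X \<omega>, y) \<partial>distr M B Y) = (\<integral>\<^sup>+\<omega>'. g (X \<omega>, Y \<omega>') \<partial>M)"
    if "\<omega> \<in> space M" for \<omega>
    using measurable_space[OF \<open>random_variable A X\<close> that] by (intro nn_integral_distr) measurable
  have "(\<integral>\<^sup>+\<omega>. g (X \<omega>, Y \<omega>) \<partial>M) = (\<integral>\<^sup>+z. g z \<partial>(distr M A X \<Otimes>\<^sub>M distr M B Y))"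
    unfolding eq by (simp add: nn_integral_distr)
  also have "\<dots> = (\<integral>\<^sup>+x. \<integral>\<^sup>+y. g (x, y) \<partial>distr M B Y \<partial>distr M A X)"
    by (rule Y.nn_integral_fst[symmetric]) measurable
  also have "\<dots> = (\<integral>\<^sup>+\<omega>. \<integral>\<^sup>+\<omega>'. g (X \<omega>, Y \<omega>') \<partial>M \<partial>M)"
    by (simp add: nn_integral_distr sections cong: nn_integral_cong)
  finally show ?thesis .
qed

text \<open>The partition \<open>0 \<le> s \<le> t\<close> is the one that second moments at the times \<open>s\<close> and \<open>t\<close> call for.\<close>

lemma (in prob_space) independent_increments_indep_var:
  assumes "independent_increments M X" and st: "0 \<le> s" "s \<le> t"
  shows "indep_var borel (\<lambda>\<omega>. X s \<omega> - X 0 \<omega>) borel (\<lambda>\<omega>. X t \<omega> - X s \<omega>)"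
proof -
  define \<tau> where "\<tau> i = (if i = 0 then 0 else if i = 1 then s else t)" for i :: nat
  have "indep_vars (\<lambda>_. borel) (\<lambda>i \<omega>. X (\<tau> (Suc i)) \<omega> - X (\<tau> i) \<omega>) {..<2}"
    using assms(1)[unfolded independent_increments_def, rule_format, of \<tau> 2] st
    by (simp add: \<tau>_def less_2_cases_iff)
  then have "indep_var (Pi\<^sub>M {0} (\<lambda>_. borel)) (\<lambda>\<omega>. \<lambda>i\<in>{0}. X (\<tau> (Suc i)) \<omega> - X (\<tau> i) \<omega>)
      (Pi\<^sub>M {1} (\<lambda>_. borel)) (\<lambda>\<omega>. \<lambda>i\<in>{1}. X (\<tau> (Suc i)) \<omega> - X (\<tau> i) \<omega>)"
    by (rule indep_var_restrict) auto
  then have "indep_var borel ((\<lambda>f. f 0) \<circ> (\<lambda>\<omega>. \<lambda>i\<in>{0}. X (\<tau> (Suc i)) \<omega> - X (\<tau> i) \<omega>))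
      borel ((\<lambda>f. f 1) \<circ> (\<lambda>\<omega>. \<lambda>i\<in>{1}. X (\<tau> (Suc i)) \<omega> - X (\<tau> i) \<omega>))"
    by (rule indep_var_compose) (auto intro: measurable_component_singleton)
  then show ?thesis by (simp add: \<tau>_def comp_def)
qed

text \<open>For \<open>a \<ge> 0\<close>, the smallest point of the grid of mesh \<open>1/(n + 1)\<close> that lies strictly to the right of \<open>a\<close>. Strictness
matters: \<open>right_grid n a\<close> tends to \<open>a\<close> within the punctured right neighbourhood of \<open>a\<close>.\<close>

definition right_grid :: "nat \<Rightarrow> real \<Rightarrow> real" where
  "right_grid n a = (real (nat \<lfloor>real (Suc n) * a\<rfloor>) + 1) / real (Suc n)"

text \<open>If the path is right-continuous at \<open>a \<ge> 0\<close>, this is just \<open>y a\<close>, but it depends on countably many values of the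
path only, which makes it measurable jointly in the path and the time.\<close>

definition path_at :: "(real \<Rightarrow> real) \<Rightarrow> real \<Rightarrow> real" where
  "path_at y a = lim (\<lambda>n. y (right_grid n a))"

lemma right_grid_bounds:
  assumes "a \<ge> 0"
  shows "a < right_grid n a" "right_grid n a \<le> a + 1 / real (Suc n)"
proof -
  define k where "k = real (nat \<lfloor>real (Suc n) * a\<rfloor>)"
  have "k \<le> a * real (Suc n)" "a * real (Suc n) < k + 1"
    using assms unfolding k_def by (simp_all add: floor_le_iff less_floor_iff mult.commute)
  then have "k / real (Suc n) \<le> a" "a < (k + 1) / real (Suc n)"
    by (simp_all only: pos_less_divide_eq pos_divide_le_eq of_nat_0_less_iff zero_less_Suc)
  then show "a < right_grid n a" "right_grid n a \<le> a + 1 / real (Suc n)"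
    unfolding right_grid_def k_def[symmetric] by (simp_all only: add_divide_distrib add_right_mono)
qed

lemma filterlim_right_grid:
  assumes "a \<ge> 0"
  shows "filterlim (\<lambda>n. right_grid n a) (at_right a) sequentially"
proof -
  have "(\<lambda>n. a + 1 / real (Suc n)) \<longlonglongrightarrow> a + 0"
    by (intro tendsto_intros LIMSEQ_inverse_real_of_nat[unfolded inverse_eq_divide])
  then have upper: "(\<lambda>n. a + 1 / real (Suc n)) \<longlonglongrightarrow> a" by (simp only: add_0_right)
  have "(\<lambda>n. right_grid n a) \<longlonglongrightarrow> a"
  proof (rule tendsto_sandwich[OF _ _ tendsto_const upper])
    show "\<forall>\<^sub>F n in sequentially. a \<le> right_grid n a"
      by (rule always_eventually, rule allI, rule less_imp_le, rule right_grid_bounds(1)[OF assms])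
    show "\<forall>\<^sub>F n in sequentially. right_grid n a \<le> a + 1 / real (Suc n)"
      by (rule always_eventually, rule allI, rule right_grid_bounds(2)[OF assms])
  qed
  moreover have "right_grid n a \<in> {a<..} \<and> right_grid n a \<noteq> a" for n
    using right_grid_bounds(1)[OF assms, of n] by simp
  ultimately show ?thesis unfolding filterlim_at by simp
qed

lemma path_at_eq:
  assumes "a \<ge> 0" "(y \<longlongrightarrow> y a) (at_right a)"
  shows "path_at y a = y a"
  unfolding path_at_def by (intro limI filterlim_compose[OF assms(2)] filterlim_right_grid assms(1))

lemma path_at_restrict: "path_at (\<lambda>t\<in>{0..}. y t) a = path_at y a"
proof -
  have "right_grid n a \<in> {0..}" for n by (simp add: right_grid_def)
  then show ?thesis by (simp add: path_at_def)
qed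

lemma measurable_path_at:
  "(\<lambda>z. path_at (fst z) (snd z)) \<in> borel_measurable (Pi\<^sub>M {0..} (\<lambda>_. borel) \<Otimes>\<^sub>M borel)"
proof -
  have "(\<lambda>z. fst z ((real k + 1) / real (Suc n)))
      \<in> borel_measurable (Pi\<^sub>M {0..} (\<lambda>_. borel) \<Otimes>\<^sub>M borel)" for n k :: nat
    by (rule measurable_compose[OF measurable_fst measurable_component_singleton]) simp
  then have "(\<lambda>z. fst z (right_grid n (snd z)))
      \<in> borel_measurable (Pi\<^sub>M {0..} (\<lambda>_. borel) \<Otimes>\<^sub>M borel)" for n
    unfolding right_grid_def
    by (rule measurable_compose_countable[where f = "\<lambda>k z. fst z ((real k + 1) / real (Suc n))"])
       measurable
  then show ?thesis unfolding path_at_def by (rule borel_measurable_lim_metric)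
qed

lemma measurable_random_path:
  assumes "\<And>t. t \<ge> 0 \<Longrightarrow> Y t \<in> borel_measurable P"
  shows "(\<lambda>\<omega>. \<lambda>t\<in>{0..}. Y t \<omega>) \<in> measurable P (Pi\<^sub>M {0..} (\<lambda>_. borel))"
  using assms by (intro measurable_restrict) auto

text \<open>The state of a right-continuous process at a random time is a random variable. With \<open>T\<close> a
coordinate projection this also gives joint measurability in time and outcome.\<close>

lemma measurable_process_at_random_time:
  assumes "\<And>t. t \<ge> 0 \<Longrightarrow> Y t \<in> borel_measurable P"
    and [measurable]: "f \<in> measurable Q P" "T \<in> borel_measurable Q"
  shows "(\<lambda>x. path_at (\<lambda>t. Y t (f x)) (T x)) \<in> borel_measurable Q"
proof -
  note measurable_random_path[OF assms(1), measurable] measurable_path_at[measurable]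
  have "(\<lambda>x. (\<lambda>z. path_at (fst z) (snd z)) (\<lambda>t\<in>{0..}. Y t (f x), T x)) \<in> borel_measurable Q"
    by (rule measurable_compose[OF _ measurable_path_at]) measurable
  then show ?thesis by (simp add: path_at_restrict)
qed

text \<open>Freezing an independent random time. Both sides are integrals of one measurable functional of the
two paths, against their joint law on the left and against the product of their laws on the right.
The times need to be nonnegative only almost surely, because the inverse of a stable subordinator
takes an arbitrary value on a null event.\<close>

lemma (in prob_space) nn_integral_independent_composition:
  fixes h :: "real \<times> real \<Rightarrow> ennreal"
  assumes ind: "independent_processes M X Y"
    and rc: "\<And>\<omega> t. \<omega> \<in> space M \<Longrightarrow> t \<ge> 0 \<Longrightarrow> ((\<lambda>s. Y s \<omega>) \<longlongrightarrow> Y t \<omega>) (at_right t)"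
    and st: "s \<ge> 0" "t \<ge> 0"
    and pos: "AE \<omega> in M. X s \<omega> \<ge> 0" "AE \<omega> in M. X t \<omega> \<ge> 0"
    and h[measurable]: "h \<in> borel_measurable (borel \<Otimes>\<^sub>M borel)"
  shows "(\<integral>\<^sup>+\<omega>. h (Y (X s \<omega>) \<omega>, Y (X t \<omega>) \<omega>) \<partial>M)
    = (\<integral>\<^sup>+\<omega>. \<integral>\<^sup>+\<omega>'. h (Y (X s \<omega>) \<omega>', Y (X t \<omega>) \<omega>') \<partial>M \<partial>M)"
proof -
  let ?B = "Pi\<^sub>M {0..} (\<lambda>_. borel) :: (real \<Rightarrow> real) measure"
  define H where "H z = h (path_at (snd z) (fst z s), path_at (snd z) (fst z t))"
    for z :: "(real \<Rightarrow> real) \<times> (real \<Rightarrow> real)"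
  have comp: "(\<lambda>z. path_at (snd z) (fst z r)) \<in> borel_measurable (?B \<Otimes>\<^sub>M ?B)" if "r \<ge> 0" for r
  proof -
    have "(\<lambda>z. fst z r) \<in> borel_measurable (?B \<Otimes>\<^sub>M ?B)"
      by (rule measurable_compose[OF measurable_fst measurable_component_singleton]) (use that in simp)
    then have "(\<lambda>z. (snd z, fst z r)) \<in> measurable (?B \<Otimes>\<^sub>M ?B) (?B \<Otimes>\<^sub>M borel)" by measurable
    from measurable_compose[OF this measurable_path_at] show ?thesis by simp
  qed
  note comp[OF st(1), measurable] comp[OF st(2), measurable]
  have Hm: "H \<in> borel_measurable (?B \<Otimes>\<^sub>M ?B)" unfolding H_def by measurable
  have Hval: "H (\<lambda>r\<in>{0..}. X r \<omega>, \<lambda>r\<in>{0..}. Y r \<omega>') = h (Y (X s \<omega>) \<omega>', Y (X t \<omega>) \<omega>')"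
    if "\<omega>' \<in> space M" "X s \<omega> \<ge> 0" "X t \<omega> \<ge> 0" for \<omega> \<omega>'
    using that st rc by (simp add: H_def path_at_restrict path_at_eq)
  have "(\<integral>\<^sup>+\<omega>. h (Y (X s \<omega>) \<omega>, Y (X t \<omega>) \<omega>) \<partial>M)
      = (\<integral>\<^sup>+\<omega>. H (\<lambda>r\<in>{0..}. X r \<omega>, \<lambda>r\<in>{0..}. Y r \<omega>) \<partial>M)"
    by (intro nn_integral_cong_AE) (use pos AE_space in eventually_elim, auto simp: Hval)
  also have "\<dots> = (\<integral>\<^sup>+\<omega>. \<integral>\<^sup>+\<omega>'. H (\<lambda>r\<in>{0..}. X r \<omega>, \<lambda>r\<in>{0..}. Y r \<omega>') \<partial>M \<partial>M)"
    using ind Hm unfolding independent_processes_def by (rule nn_integral_indep_var)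
  also have "\<dots> = (\<integral>\<^sup>+\<omega>. \<integral>\<^sup>+\<omega>'. h (Y (X s \<omega>) \<omega>', Y (X t \<omega>) \<omega>') \<partial>M \<partial>M)"
    by (intro nn_integral_cong_AE, use pos in eventually_elim)
       (auto intro!: nn_integral_cong simp: Hval)
  finally show ?thesis .
qed

section \<open>Moments of the Poisson process\<close>

text \<open>With \<open>p k\<close> the Poisson weights, \<open>(k + 1) p (k + 1) = r p k\<close> reduces each moment to the one below.\<close>

lemma poisson_moment_sums:
  fixes r :: real
  defines "p \<equiv> (\<lambda>k::nat. exp (- r) * r ^ k / fact k)"
  shows "(\<lambda>k. real k * p k) sums r" "(\<lambda>k. (real k)\<^sup>2 * p k) sums (r + r\<^sup>2)"
proof -
  have "(\<lambda>k. exp (- r) * (r ^ k /\<^sub>R fact k)) sums (exp (- r) * exp r)"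
    by (intro sums_mult exp_converges)
  then have p: "p sums 1" by (simp add: p_def divide_inverse mult_ac exp_minus)
  have shift: "real (Suc k) * p (Suc k) = r * p k" for k
    by (simp add: p_def field_simps del: of_nat_Suc)
  have "(\<lambda>k. real (Suc k) * p (Suc k)) sums (r * 1)"
    unfolding shift using p by (rule sums_mult)
  then show m1: "(\<lambda>k. real k * p k) sums r"
    by (subst (asm) sums_Suc_iff) simp
  have "(\<lambda>k. r * (real k * p k) + r * p k) sums (r * r + r * 1)"
    by (intro sums_add sums_mult m1 p)
  moreover have "(real (Suc k))\<^sup>2 * p (Suc k) = r * (real k * p k) + r * p k" for k
  proof -
    have "(real (Suc k))\<^sup>2 * p (Suc k) = (real k + 1) * (real (Suc k) * p (Suc k))"
      by (simp add: power2_eq_square)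
    then show ?thesis unfolding shift by (simp only: distrib_right distrib_left mult_1 mult_ac)
  qed
  ultimately have "(\<lambda>k. (real (Suc k))\<^sup>2 * p (Suc k)) sums (r * r + r * 1)" by simp
  then show "(\<lambda>k. (real k)\<^sup>2 * p k) sums (r + r\<^sup>2)"
    by (subst (asm) sums_Suc_iff) (simp add: power2_eq_square add.commute)
qed

lemma (in prob_space) nn_integral_nat_valued:
  fixes X :: "'a \<Rightarrow> nat" and f :: "nat \<Rightarrow> real"
  assumes X[measurable]: "X \<in> measurable M (count_space UNIV)"
    and f: "\<And>k. f k \<ge> 0" and s: "(\<lambda>k. f k * prob {\<omega> \<in> space M. X \<omega> = k}) sums l"
  shows "(\<integral>\<^sup>+\<omega>. ennreal (f (X \<omega>)) \<partial>M) = ennreal l"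
proof -
  have "(\<integral>\<^sup>+\<omega>. ennreal (f (X \<omega>)) \<partial>M)
      = (\<integral>\<^sup>+\<omega>. (\<Sum>k. ennreal (f k) * indicator {\<omega> \<in> space M. X \<omega> = k} \<omega>) \<partial>M)"
  proof (rule nn_integral_cong)
    fix \<omega> assume "\<omega> \<in> space M"
    then have "(\<lambda>k. ennreal (f k) * indicator {\<omega> \<in> space M. X \<omega> = k} \<omega>)
        = (\<lambda>k. if k = X \<omega> then ennreal (f k) else 0)"
      by (auto simp: fun_eq_iff)
    then show "ennreal (f (X \<omega>)) = (\<Sum>k. ennreal (f k) * indicator {\<omega> \<in> space M. X \<omega> = k} \<omega>)"
      using sums_unique[OF sums_single[of "X \<omega>" "\<lambda>k. ennreal (f k)"]] by simp
  qed
  also have "\<dots> = (\<Sum>k. \<integral>\<^sup>+\<omega>. ennreal (f k) * indicator {\<omega> \<in> space M. X \<omega> = k} \<omega> \<partial>M)"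
    by (rule nn_integral_suminf) measurable
  also have "\<dots> = (\<Sum>k. ennreal (f k * prob {\<omega> \<in> space M. X \<omega> = k}))"
    using f by (simp add: nn_integral_cmult_indicator emeasure_eq_measure ennreal_mult)
  also have "\<dots> = ennreal l"
    using s f by (intro suminf_ennreal_eq) auto
  finally show ?thesis .
qed

lemma (in prob_space) poisson_process_moments:
  assumes N: "poisson_process M lam N" and xy: "0 \<le> x" "x \<le> y"
  shows "(\<integral>\<^sup>+\<omega>. ennreal (real (N x \<omega>)) \<partial>M) = ennreal (lam * x)"
    and "(\<integral>\<^sup>+\<omega>. ennreal (real (N x \<omega>) * real (N y \<omega>)) \<partial>M) = ennreal (lam * x + lam\<^sup>2 * x * y)"
proof -
  have Nm: "N t \<in> measurable M (count_space UNIV)" if "t \<ge> 0" for t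
    using N that by (simp add: poisson_process_def measurable_cong_sets[OF refl sets_borel_eq_count_space])
  have mono: "N s \<omega> \<le> N t \<omega>" if "0 \<le> s" "s \<le> t" "\<omega> \<in> space M" for s t \<omega>
    using N that by (auto simp: poisson_process_def mono_on_def)
  have N0: "N 0 \<omega> = 0" if "\<omega> \<in> space M" for \<omega> using N that by (auto simp: poisson_process_def)
  have law: "prob {\<omega> \<in> space M. N t \<omega> - N s \<omega> = k} = exp (- (lam * (t - s))) * (lam * (t - s)) ^ k / fact k"
    if "0 \<le> s" "s \<le> t" for s t k
    using N that by (auto simp: poisson_process_def)
  have m1: "(\<integral>\<^sup>+\<omega>. ennreal (real (N t \<omega> - N s \<omega>)) \<partial>M) = ennreal (lam * (t - s))"
    if "0 \<le> s" "s \<le> t" for s t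
    using Nm poisson_moment_sums(1)[of "lam * (t - s)"] that
    by (intro nn_integral_nat_valued[of _ real]) (simp_all only: law, simp_all)
  have m2: "(\<integral>\<^sup>+\<omega>. ennreal ((real (N x \<omega> - N 0 \<omega>))\<^sup>2) \<partial>M) = ennreal (lam * x + (lam * x)\<^sup>2)"
    using Nm poisson_moment_sums(2)[of "lam * x"] xy
    by (intro nn_integral_nat_valued[of _ "\<lambda>k. (real k)\<^sup>2"]) (simp_all only: law order_refl, simp_all)
  show first: "(\<integral>\<^sup>+\<omega>. ennreal (real (N x \<omega>)) \<partial>M) = ennreal (lam * x)"
    using m1[of 0 x] xy by (simp add: N0 cong: nn_integral_cong)
  have ind: "indep_var borel (\<lambda>\<omega>. real (N x \<omega>) - real (N 0 \<omega>)) borel (\<lambda>\<omega>. real (N y \<omega>) - real (N x \<omega>))"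
    using N xy by (intro independent_increments_indep_var) (auto simp: poisson_process_def)
  have lam: "lam * (t - s) \<ge> 0" if "0 \<le> s" "s \<le> t" for s t
  proof -
    have "0 \<le> exp (- (lam * (t - s))) * (lam * (t - s)) ^ 1 / fact 1"
      using measure_nonneg[of M] unfolding law[OF that, symmetric] by simp
    then show ?thesis by (simp add: zero_le_mult_iff)
  qed
  have xn: "N x \<in> measurable M (count_space UNIV)" and yn: "N y \<in> measurable M (count_space UNIV)"
    using xy by (auto intro: Nm)
  note [measurable] = xn yn
  \<comment> \<open>Write \<open>N(x)N(y) = N(x)\<^sup>2 + N(x)(N(y) - N(x))\<close>, where the two factors of the last product are independent.\<close>
  have "(\<integral>\<^sup>+\<omega>. ennreal (real (N x \<omega>) * real (N y \<omega>)) \<partial>M)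
      = (\<integral>\<^sup>+\<omega>. ennreal ((real (N x \<omega>))\<^sup>2) + ennreal (real (N x \<omega>)) * ennreal (real (N y \<omega>) - real (N x \<omega>)) \<partial>M)"
  proof (rule nn_integral_cong)
    fix \<omega> assume "\<omega> \<in> space M"
    then have "real (N x \<omega>) \<le> real (N y \<omega>)" using mono xy by simp
    then show "ennreal (real (N x \<omega>) * real (N y \<omega>))
      = ennreal ((real (N x \<omega>))\<^sup>2) + ennreal (real (N x \<omega>)) * ennreal (real (N y \<omega>) - real (N x \<omega>))"
      by (subst ennreal_mult[symmetric], simp, simp, subst ennreal_plus[symmetric])
         (simp_all add: power2_eq_square right_diff_distrib mult_left_mono)
  qed
  also have "\<dots> = (\<integral>\<^sup>+\<omega>. ennreal ((real (N x \<omega>))\<^sup>2) \<partial>M)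
      + (\<integral>\<^sup>+\<omega>. ennreal (real (N x \<omega>)) * ennreal (real (N y \<omega>) - real (N x \<omega>)) \<partial>M)"
    by (rule nn_integral_add) measurable
  also have "(\<integral>\<^sup>+\<omega>. ennreal (real (N x \<omega>)) * ennreal (real (N y \<omega>) - real (N x \<omega>)) \<partial>M)
      = (\<integral>\<^sup>+\<omega>. \<integral>\<^sup>+\<omega>'. ennreal (real (N x \<omega>)) * ennreal (real (N y \<omega>') - real (N x \<omega>')) \<partial>M \<partial>M)"
    using nn_integral_indep_var[OF ind, of "\<lambda>z. ennreal (fst z) * ennreal (snd z)"]
    by (simp add: N0 cong: nn_integral_cong)
  also have "\<dots> = (\<integral>\<^sup>+\<omega>. ennreal (real (N x \<omega>)) * ennreal (lam * (y - x)) \<partial>M)"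
  proof (rule nn_integral_cong)
    fix \<omega>
    have "(\<integral>\<^sup>+\<omega>'. ennreal (real (N y \<omega>') - real (N x \<omega>')) \<partial>M) = ennreal (lam * (y - x))"
      unfolding m1[OF xy, symmetric] using mono[OF xy] by (intro nn_integral_cong) simp
    then show "(\<integral>\<^sup>+\<omega>'. ennreal (real (N x \<omega>)) * ennreal (real (N y \<omega>') - real (N x \<omega>')) \<partial>M)
       = ennreal (real (N x \<omega>)) * ennreal (lam * (y - x))"
      by (subst nn_integral_cmult) auto
  qed
  also have "\<dots> = ennreal (lam * x) * ennreal (lam * (y - x))"
    by (subst nn_integral_multc) (auto simp: first)
  also have "(\<integral>\<^sup>+\<omega>. ennreal ((real (N x \<omega>))\<^sup>2) \<partial>M) = ennreal (lam * x + (lam * x)\<^sup>2)"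
    using m2 by (simp add: N0 cong: nn_integral_cong)
  also have "ennreal (lam * x + (lam * x)\<^sup>2) + ennreal (lam * x) * ennreal (lam * (y - x))
      = ennreal (lam * x + lam\<^sup>2 * x * y)"
  proof -
    define A B where "A = lam * x" and "B = lam * (y - x)"
    have "A \<ge> 0" "B \<ge> 0" using lam[of 0 x] lam[OF xy] xy by (simp_all add: A_def B_def)
    then have "ennreal (A + A\<^sup>2) + ennreal A * ennreal B = ennreal (A + A\<^sup>2 + A * B)"
      by (simp add: ennreal_mult)
    also have "A + A\<^sup>2 + A * B = lam * x + lam\<^sup>2 * x * y"
      by (simp add: A_def B_def power2_eq_square algebra_simps)
    finally show ?thesis by (simp only: A_def B_def)
  qed
  finally show "(\<integral>\<^sup>+\<omega>. ennreal (real (N x \<omega>) * real (N y \<omega>)) \<partial>M) = ennreal (lam * x + lam\<^sup>2 * x * y)" .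
qed

section \<open>Potential measure of a stable subordinator\<close>

lemma subordinator_properties:
  assumes "subordinator P S"
  shows "t \<ge> 0 \<Longrightarrow> S t \<in> borel_measurable P"
    and "\<omega> \<in> space P \<Longrightarrow> S 0 \<omega> = 0"
    and "\<omega> \<in> space P \<Longrightarrow> 0 \<le> r \<Longrightarrow> r \<le> t \<Longrightarrow> S r \<omega> \<le> S t \<omega>"
    and "\<omega> \<in> space P \<Longrightarrow> t \<ge> 0 \<Longrightarrow> S t \<omega> \<ge> 0"
    and "\<omega> \<in> space P \<Longrightarrow> t \<ge> 0 \<Longrightarrow> path_at (\<lambda>t. S t \<omega>) t = S t \<omega>"
proof -
  have L: "levy_process P S" and mono: "\<And>\<omega>. \<omega> \<in> space P \<Longrightarrow> mono_on {0..} (\<lambda>t. S t \<omega>)"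
    using assms by (auto simp: subordinator_def)
  show "t \<ge> 0 \<Longrightarrow> S t \<in> borel_measurable P" and zero: "\<omega> \<in> space P \<Longrightarrow> S 0 \<omega> = 0"
    using L by (auto simp: levy_process_def)
  show m: "\<omega> \<in> space P \<Longrightarrow> 0 \<le> r \<Longrightarrow> r \<le> t \<Longrightarrow> S r \<omega> \<le> S t \<omega>" for r
    using mono[of \<omega>] by (auto simp: mono_on_def)
  show "\<omega> \<in> space P \<Longrightarrow> t \<ge> 0 \<Longrightarrow> S t \<omega> \<ge> 0"
    using m[of 0] zero by simp
  show "\<omega> \<in> space P \<Longrightarrow> t \<ge> 0 \<Longrightarrow> path_at (\<lambda>t. S t \<omega>) t = S t \<omega>"
    using L by (intro path_at_eq) (auto simp: levy_process_def cadlag_path_def continuous_within)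
qed

lemma (in prob_space) nn_integral_exp_eq_expectation:
  assumes [measurable]: "X \<in> borel_measurable M" and "\<And>\<omega>. \<omega> \<in> space M \<Longrightarrow> X \<omega> \<ge> 0" "u \<ge> 0"
  shows "(\<integral>\<^sup>+\<omega>. ennreal (exp (- u * X \<omega>)) \<partial>M) = ennreal (expectation (\<lambda>\<omega>. exp (- u * X \<omega>)))"
proof (rule nn_integral_eq_integral)
  show "integrable M (\<lambda>\<omega>. exp (- u * X \<omega>))"
    using assms(2,3) by (intro integrable_const_bound[of _ 1] AE_I2) auto
qed simp

lemma nn_integral_incomplete_Beta:
  fixes a b x :: real
  assumes ab: "a > 0" "b > 0" and x: "x \<le> 1"
  shows "(\<integral>\<^sup>+v\<in>{0..x}. ennreal (v powr (a - 1) * (1 - v) powr (b - 1)) \<partial>lborel) = ennreal (incomplete_Beta a b x)"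
proof -
  have "set_integrable lborel {0..x} (\<lambda>v. v powr (a - 1) * (1 - v) powr (b - 1))"
    by (rule set_integrable_subset[OF integrable_Beta[OF ab]]) (use x in auto)
  then have "(\<integral>\<^sup>+v. ennreal (indicator {0..x} v *\<^sub>R (v powr (a - 1) * (1 - v) powr (b - 1))) \<partial>lborel)
      = ennreal (incomplete_Beta a b x)"
    unfolding incomplete_Beta_def set_lebesgue_integral_def set_integrable_def
    by (rule nn_integral_eq_integral) simp
  moreover have "ennreal (v powr (a - 1) * (1 - v) powr (b - 1)) * indicator {0..x} v
      = ennreal (indicator {0..x} v *\<^sub>R (v powr (a - 1) * (1 - v) powr (b - 1)))" for v
    by (simp add: indicator_def)
  ultimately show ?thesis by (simp only:)
qed

lemma incomplete_Beta_nonneg: "incomplete_Beta a b x \<ge> 0"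
  unfolding incomplete_Beta_def set_lebesgue_integral_def by (rule integral_nonneg_AE) simp

lemma incomplete_Beta_one:
  assumes "a > 0" "b > 0"
  shows "incomplete_Beta a b 1 = Beta a b"
  using has_integral_Beta_real[OF assms] set_borel_integral_eq_integral[OF integrable_Beta[OF assms]]
  by (simp add: incomplete_Beta_def has_integral_iff)

lemma Beta_nonneg:
  assumes "a > 0" "b > (0 :: real)"
  shows "Beta a b \<ge> 0"
  using incomplete_Beta_nonneg[of a b 1] by (simp add: incomplete_Beta_one assms)

lemma measurable_incomplete_Beta [measurable]: "incomplete_Beta a b \<in> borel_measurable borel"
proof -
  have "(\<lambda>z. if 0 \<le> snd z \<and> snd z \<le> fst z then snd z powr (a - 1) * (1 - snd z) powr (b - 1) else 0)
      \<in> borel_measurable (borel \<Otimes>\<^sub>M lborel)"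
    by measurable
  then have "(\<lambda>x. \<integral>v. (if 0 \<le> v \<and> v \<le> x then v powr (a - 1) * (1 - v) powr (b - 1) else 0) \<partial>lborel)
      \<in> borel_measurable borel"
    by (intro lborel.borel_measurable_lebesgue_integral) (simp add: split_beta')
  moreover have "incomplete_Beta a b x
      = (\<integral>v. (if 0 \<le> v \<and> v \<le> x then v powr (a - 1) * (1 - v) powr (b - 1) else 0) \<partial>lborel)" for x
    unfolding incomplete_Beta_def set_lebesgue_integral_def
    by (intro Bochner_Integration.integral_cong) (simp_all add: indicator_def)
  ultimately show ?thesis by (subst measurable_cong) auto
qed

text \<open>Scaling \<open>x = bv\<close> gives an incomplete beta integral over \<open>[0, a/b]\<close>. For \<open>b = 0\<close> both sides
vanish, since \<open>0 powr (2 * \<beta>) = 0\<close>.\<close>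

lemma nn_integral_Beta_kernel:
  fixes a b \<beta> :: real
  assumes \<beta>: "\<beta> > 0" and ab: "0 \<le> a" "a \<le> b"
  shows "(\<integral>\<^sup>+x\<in>{0<..}. indicator {..a} x * ennreal ((b - x) powr \<beta>) * ennreal (x powr (\<beta> - 1)) \<partial>lborel)
     = ennreal (b powr (2 * \<beta>) * incomplete_Beta \<beta> (1 + \<beta>) (a / b))"
proof (cases "b = 0")
  case True
  then have "indicator {..a} x * ennreal ((b - x) powr \<beta>) * ennreal (x powr (\<beta> - 1)) * indicator {0<..} x = 0" for x
    using ab by (simp add: indicator_def)
  then show ?thesis using True by (simp only: nn_integral_const) simp
next
  case False
  then have b: "b > 0" using ab by simp
  have "(\<integral>\<^sup>+x\<in>{0<..}. indicator {..a} x * ennreal ((b - x) powr \<beta>) * ennreal (x powr (\<beta> - 1)) \<partial>lborel)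
      = ennreal \<bar>b\<bar> * (\<integral>\<^sup>+v. indicator {..a} (0 + b * v) * ennreal ((b - (0 + b * v)) powr \<beta>)
          * ennreal ((0 + b * v) powr (\<beta> - 1)) * indicator {0<..} (0 + b * v) \<partial>lborel)"
    by (rule nn_integral_real_affine) (use False in auto)
  also have "\<dots> = (\<integral>\<^sup>+v. ennreal \<bar>b\<bar> * (indicator {..a} (0 + b * v) * ennreal ((b - (0 + b * v)) powr \<beta>)
          * ennreal ((0 + b * v) powr (\<beta> - 1)) * indicator {0<..} (0 + b * v)) \<partial>lborel)"
    by (rule nn_integral_cmult[symmetric]) measurable
  also have "\<dots> = (\<integral>\<^sup>+v. ennreal (b powr (2 * \<beta>)) *
      (ennreal (v powr (\<beta> - 1) * (1 - v) powr (1 + \<beta> - 1)) * indicator {0..a / b} v) \<partial>lborel)"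
  proof (rule nn_integral_cong)
    fix v :: real
    show "ennreal \<bar>b\<bar> * (indicator {..a} (0 + b * v) * ennreal ((b - (0 + b * v)) powr \<beta>)
          * ennreal ((0 + b * v) powr (\<beta> - 1)) * indicator {0<..} (0 + b * v))
        = ennreal (b powr (2 * \<beta>)) *
      (ennreal (v powr (\<beta> - 1) * (1 - v) powr (1 + \<beta> - 1)) * indicator {0..a / b} v)"
    proof (cases "0 < v \<and> v \<le> a / b")
      case True
      then have v: "0 < v" "v \<le> 1" "b * v \<le> a" "v \<le> a / b"
        using ab b order_trans[of v "a / b" 1] by (auto simp: field_simps)
      have "b - b * v = b * (1 - v)" by (simp add: algebra_simps)
      then have "(b - b * v) powr \<beta> = b powr \<beta> * (1 - v) powr \<beta>"
        using v b by (simp add: powr_mult)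
      moreover have "(b * v) powr (\<beta> - 1) = b powr (\<beta> - 1) * v powr (\<beta> - 1)"
        using v b by (simp add: powr_mult)
      moreover have "b * b powr \<beta> * b powr (\<beta> - 1) = b powr (2 * \<beta>)"
        using b powr_add[of b 1 "\<beta> + (\<beta> - 1)"] powr_add[of b \<beta> "\<beta> - 1"] by simp
      ultimately have "b * ((b - b * v) powr \<beta> * (b * v) powr (\<beta> - 1))
          = b powr (2 * \<beta>) * (v powr (\<beta> - 1) * (1 - v) powr \<beta>)"
        by (simp add: mult_ac)
      then show ?thesis using v b by (simp add: ennreal_mult'[symmetric])
    next
      case False
      then consider "v < 0" | "v = 0" | "v > a / b" by linarith
      then show ?thesis
        using b by cases (auto simp: indicator_def zero_less_mult_iff field_simps)
    qed
  qed
  also have "\<dots> = ennreal (b powr (2 * \<beta>)) * ennreal (incomplete_Beta \<beta> (1 + \<beta>) (a / b))"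
    using \<beta> ab b by (subst nn_integral_cmult) (simp_all add: nn_integral_incomplete_Beta[symmetric])
  finally show ?thesis by (simp add: ennreal_mult incomplete_Beta_nonneg)
qed

text \<open>A nondecreasing path is at most \<open>a\<close> before its first passage over \<open>a\<close> and greater than \<open>a\<close>
afterwards, so the first passage time is the total time spent below \<open>a\<close>. At the passage time itself
either may happen, which does not affect the integral.\<close>

lemma occupation_time_below_level:
  assumes mono: "\<And>r t. 0 \<le> r \<Longrightarrow> r \<le> t \<Longrightarrow> S r \<omega> \<le> S t \<omega>" and ex: "\<exists>r\<ge>0. S r \<omega> > a"
  shows "(\<integral>\<^sup>+r\<in>{0..}. indicator {..a} (S r \<omega>) \<partial>lborel) = ennreal (inverse_process S a \<omega>)"
    and "inverse_process S a \<omega> \<ge> 0"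
proof -
  define A where "A = {r. 0 \<le> r \<and> S r \<omega> > a}"
  define e where "e = inverse_process S a \<omega>"
  have A: "A \<noteq> {}" "bdd_below A" using ex by (auto simp: A_def intro!: bdd_belowI[of _ 0])
  have e: "e = Inf A" by (simp add: e_def inverse_process_def A_def)
  show e0: "inverse_process S a \<omega> \<ge> 0"
    unfolding e_def[symmetric] e using A by (intro cInf_greatest) (auto simp: A_def)
  have below: "S r \<omega> \<le> a" if "0 \<le> r" "r < e" for r
  proof (rule ccontr)
    assume "\<not> S r \<omega> \<le> a"
    then have "r \<in> A" using that by (simp add: A_def)
    from cInf_lower[OF this A(2)] show False using that by (simp add: e)
  qed
  have above: "S r \<omega> > a" if "r > e" for r
  proof -
    obtain r' where "r' \<in> A" "r' < r" using cInf_lessD[OF A(1)] \<open>r > e\<close> e by auto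
    then show ?thesis using mono[of r' r] by (auto simp: A_def)
  qed
  have "(\<integral>\<^sup>+r\<in>{0..}. indicator {..a} (S r \<omega>) \<partial>lborel) = (\<integral>\<^sup>+r. indicator {0..e} r \<partial>lborel)"
  proof (rule nn_integral_cong_AE)
    have "AE r in lborel. r \<noteq> e" by (rule AE_lborel_singleton)
    then show "AE r in lborel. indicator {..a} (S r \<omega>) * indicator {0..} r = (indicator {0..e} r :: ennreal)"
    proof eventually_elim
      case (elim r)
      then show ?case using below[of r] above[of r] e0 unfolding e_def[symmetric]
        by (cases "r < e") (auto simp: indicator_def)
    qed
  qed
  also have "\<dots> = ennreal e" using e0 by (simp add: e_def)
  finally show "(\<integral>\<^sup>+r\<in>{0..}. indicator {..a} (S r \<omega>) \<partial>lborel) = ennreal (inverse_process S a \<omega>)"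
    by (simp add: e_def)
qed

lemma inverse_process_mono:
  assumes ex: "\<exists>r\<ge>0. S r \<omega> > b" and "a \<le> b"
  shows "inverse_process S a \<omega> \<le> inverse_process S b \<omega>"
  unfolding inverse_process_def using assms
  by (intro cInf_superset_mono) (auto intro!: bdd_belowI[of _ 0])

context prob_space begin

text \<open>The time is cut off at \<open>0\<close> because nothing is known about the process at negative times.\<close>

lemma measurable_joint_process:
  assumes "subordinator M S"
  shows "(\<lambda>z. S (max 0 (fst z)) (snd z)) \<in> borel_measurable (borel \<Otimes>\<^sub>M M)"
proof -
  note sp = subordinator_properties[OF assms]
  have "(\<lambda>z. path_at (\<lambda>t. S t (snd z)) (max 0 (fst z))) \<in> borel_measurable (borel \<Otimes>\<^sub>M M)"
    by (rule measurable_process_at_random_time[of S M snd _ "\<lambda>z. max 0 (fst z)"]) (simp_all add: sp(1))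
  then show ?thesis
    by (rule measurable_cong[THEN iffD1, rotated]) (auto simp: sp(5) space_pair_measure)
qed

text \<open>The expected time that a \<open>\<beta>\<close>-stable subordinator spends in a set is given by the density
\<open>x\<^sup>\<beta>\<^sup>-\<^sup>1/\<Gamma>(\<beta>)\<close>: both measures have Laplace transform \<open>u\<^sup>-\<^sup>\<beta>\<close>.\<close>

lemma stable_potential_measure:
  fixes g :: "real \<Rightarrow> ennreal"
  assumes S: "stable_subordinator M \<beta> S" and \<beta>: "\<beta> > 0" and g[measurable]: "g \<in> borel_measurable borel"
  shows "(\<integral>\<^sup>+r\<in>{0..}. (\<integral>\<^sup>+\<omega>. g (S r \<omega>) \<partial>M) \<partial>lborel)
       = (\<integral>\<^sup>+x\<in>{0<..}. g x * ennreal (x powr (\<beta> - 1) / Gamma \<beta>) \<partial>lborel)"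
proof -
  have sub: "subordinator M S" using S by (simp add: stable_subordinator_def)
  note sp = subordinator_properties[OF sub]
  define p where "p z = S (max 0 (fst z)) (snd z)" for z
  have pb[measurable]: "p \<in> borel_measurable (borel \<Otimes>\<^sub>M M)"
    unfolding p_def using measurable_joint_process[OF sub] by simp
  have pl[measurable]: "p \<in> borel_measurable (lborel \<Otimes>\<^sub>M M)"
    using pb by (simp only: measurable_cong_sets[OF sets_pair_measure_cong[OF sets_lborel refl] refl])
  have p: "p (r, \<omega>) = S r \<omega>" if "r \<ge> 0" for r \<omega>
    using that by (simp add: p_def)
  define L where "L = density lborel (indicator {0..} :: real \<Rightarrow> ennreal)"
  have sets_L[measurable_cong]: "sets L = sets borel" by (simp add: L_def)
  define K1 where "K1 = distr (L \<Otimes>\<^sub>M M) borel p"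
  define K2 where "K2 = density lborel (\<lambda>x. ennreal (x powr (\<beta> - 1) / Gamma \<beta>) * indicator {0<..} x)"
  have pL[measurable]: "p \<in> borel_measurable (L \<Otimes>\<^sub>M M)"
    using pb by (simp only: measurable_cong_sets[OF sets_pair_measure_cong[OF sets_L refl] refl])
  have I1: "(\<integral>\<^sup>+x. f x \<partial>K1) = (\<integral>\<^sup>+r\<in>{0..}. (\<integral>\<^sup>+\<omega>. f (S r \<omega>) \<partial>M) \<partial>lborel)"
    if [measurable]: "f \<in> borel_measurable borel" for f :: "real \<Rightarrow> ennreal"
  proof -
    have "(\<integral>\<^sup>+x. f x \<partial>K1) = (\<integral>\<^sup>+z. f (p z) \<partial>(L \<Otimes>\<^sub>M M))"
      unfolding K1_def by (simp add: nn_integral_distr)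
    also have "\<dots> = (\<integral>\<^sup>+r. \<integral>\<^sup>+\<omega>. f (p (r, \<omega>)) \<partial>M \<partial>L)"
      by (rule nn_integral_fst[symmetric]) measurable
    also have "\<dots> = (\<integral>\<^sup>+r. indicator {0..} r * (\<integral>\<^sup>+\<omega>. f (p (r, \<omega>)) \<partial>M) \<partial>lborel)"
      unfolding L_def by (rule nn_integral_density) measurable
    also have "\<dots> = (\<integral>\<^sup>+r\<in>{0..}. (\<integral>\<^sup>+\<omega>. f (S r \<omega>) \<partial>M) \<partial>lborel)"
      by (intro nn_integral_cong) (auto simp: indicator_def p cong: nn_integral_cong)
    finally show ?thesis .
  qed
  have I2: "(\<integral>\<^sup>+x. f x \<partial>K2) = (\<integral>\<^sup>+x\<in>{0<..}. f x * ennreal (x powr (\<beta> - 1) / Gamma \<beta>) \<partial>lborel)"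
    if [measurable]: "f \<in> borel_measurable borel" for f :: "real \<Rightarrow> ennreal"
    unfolding K2_def by (subst nn_integral_density) (auto intro!: nn_integral_cong simp: mult_ac)
  have "K1 = K2"
  proof (rule Laplace_transform_determines_measure[where L = "\<lambda>u. 1 / u powr \<beta>"])
    show "sets K1 = sets borel" "sets K2 = sets borel" by (simp_all add: K1_def K2_def)
    show "AE x in K1. x \<ge> 0"
    proof -
      have vanish: "(\<integral>\<^sup>+\<omega>. indicator {..<0} (S r \<omega>) \<partial>M) * indicator {0..} r = (0::ennreal)" for r
      proof (cases "r \<ge> 0")
        case True
        then have "(\<integral>\<^sup>+\<omega>. indicator {..<0} (S r \<omega>) \<partial>M) = (\<integral>\<^sup>+\<omega>. (0::ennreal) \<partial>M)"
          using sp(4) by (intro nn_integral_cong) (simp add: indicator_def not_less)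
        then show ?thesis by simp
      qed simp
      have "(\<integral>\<^sup>+x. indicator {..<0} x \<partial>K1) = 0"
        by (subst I1, measurable) (simp only: vanish, simp)
      then show ?thesis
        by (subst (asm) nn_integral_0_iff_AE) (auto simp: K1_def indicator_def elim!: AE_mp)
    qed
    show "AE x in K2. x \<ge> 0"
      unfolding K2_def by (subst AE_density) (auto simp: indicator_def)
    show "(\<integral>\<^sup>+x. ennreal (exp (- u * x)) \<partial>K1) = ennreal (1 / u powr \<beta>)" if u: "u > 0" for u
    proof -
      have "(\<integral>\<^sup>+x. ennreal (exp (- u * x)) \<partial>K1) = (\<integral>\<^sup>+r\<in>{0..}. (\<integral>\<^sup>+\<omega>. ennreal (exp (- u * S r \<omega>)) \<partial>M) \<partial>lborel)"
        by (rule I1) measurable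
      also have "\<dots> = (\<integral>\<^sup>+r\<in>{0..}. ennreal (exp (- r * u powr \<beta>)) \<partial>lborel)"
      proof (rule nn_integral_cong)
        fix r :: real
        show "(\<integral>\<^sup>+\<omega>. ennreal (exp (- u * S r \<omega>)) \<partial>M) * indicator {0..} r = ennreal (exp (- r * u powr \<beta>)) * indicator {0..} r"
        proof (cases "r \<ge> 0")
          case True
          have "(\<integral>\<^sup>+\<omega>. ennreal (exp (- u * S r \<omega>)) \<partial>M) = ennreal (expectation (\<lambda>\<omega>. exp (- u * S r \<omega>)))"
            by (rule nn_integral_exp_eq_expectation) (use True sp u in auto)
          also have "expectation (\<lambda>\<omega>. exp (- u * S r \<omega>)) = exp (- r * u powr \<beta>)"
            using S u True by (auto simp: stable_subordinator_def)
          finally show ?thesis by simp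
        qed simp
      qed
      also have "\<dots> = ennreal (1 / u powr \<beta>)"
        using u by (intro nn_integral_exp_times_Ici) simp
      finally show ?thesis .
    qed
    show "(\<integral>\<^sup>+x. ennreal (exp (- u * x)) \<partial>K2) = ennreal (1 / u powr \<beta>)" if u: "u > 0" for u
    proof -
      have G: "Gamma \<beta> > 0" using \<beta> by (rule Gamma_real_pos)
      have "(\<integral>\<^sup>+x. ennreal (exp (- u * x)) \<partial>K2)
          = (\<integral>\<^sup>+x\<in>{0<..}. ennreal (exp (- u * x)) * ennreal (x powr (\<beta> - 1) / Gamma \<beta>) \<partial>lborel)"
        by (rule I2) measurable
      also have "\<dots> = (\<integral>\<^sup>+x. ennreal (1 / Gamma \<beta>) *
          (ennreal (x powr (1 * \<beta> - 1) * exp (- u * x powr 1)) * indicator {0<..} x) \<partial>lborel)"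
        using G by (intro nn_integral_cong) (auto simp: indicator_def ennreal_mult[symmetric])
      also have "\<dots> = ennreal (1 / Gamma \<beta>) * ennreal (Gamma \<beta> / (1 * u powr \<beta>))"
        using \<beta> u by (subst nn_integral_cmult) (auto simp only: nn_integral_Gamma_powr, measurable)
      also have "\<dots> = ennreal (1 / u powr \<beta>)"
        using G by (simp add: ennreal_mult'[symmetric])
      finally show ?thesis .
    qed
  qed simp
  then show ?thesis using I1[OF g] I2[OF g] by simp
qed

end

context prob_space begin

text \<open>Given \<open>S(r)\<close>, the increment \<open>S(r + h) - S(r)\<close> is an independent copy of \<open>S(h)\<close>; so integrating over
\<open>h\<close> produces one factor of the potential density and integrating over \<open>r\<close> another.\<close>

lemma stable_potential_two_times:
  fixes F :: "real \<times> real \<Rightarrow> ennreal"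
  assumes S: "stable_subordinator M \<beta> S" and \<beta>: "\<beta> > 0"
    and F[measurable]: "F \<in> borel_measurable (borel \<Otimes>\<^sub>M borel)"
  shows "(\<integral>\<^sup>+\<omega>. (\<integral>\<^sup>+r\<in>{0..}. (\<integral>\<^sup>+h\<in>{0..}. F (S r \<omega>, S (r + h) \<omega>) \<partial>lborel) \<partial>lborel) \<partial>M)
    = (\<integral>\<^sup>+x\<in>{0<..}. (\<integral>\<^sup>+y\<in>{0<..}. F (x, x + y) * ennreal (y powr (\<beta> - 1) / Gamma \<beta>) \<partial>lborel)
         * ennreal (x powr (\<beta> - 1) / Gamma \<beta>) \<partial>lborel)"
proof -
  have sub: "subordinator M S" using S by (simp add: stable_subordinator_def)
  note sp = subordinator_properties[OF sub]
  interpret lM: pair_sigma_finite lborel M ..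
  define p where "p z = S (max 0 (fst z)) (snd z)" for z
  have pb: "p \<in> borel_measurable (borel \<Otimes>\<^sub>M M)"
    unfolding p_def using measurable_joint_process[OF sub] by simp
  have [measurable]: "p \<in> borel_measurable (lborel \<Otimes>\<^sub>M M)"
    using pb by (simp only: measurable_cong_sets[OF sets_pair_measure_cong[OF sets_lborel refl] refl])
  note pb[measurable]
  have p: "p (r, \<omega>) = S r \<omega>" if "r \<ge> 0" for r \<omega>
    using that by (simp add: p_def)
  \<comment> \<open>The result of integrating over \<open>h\<close>, as a function of the position \<open>x = S(r)\<close>.\<close>
  define G where "G x = (\<integral>\<^sup>+y\<in>{0<..}. F (x, x + y) * ennreal (y powr (\<beta> - 1) / Gamma \<beta>) \<partial>lborel)" for x
  have [measurable]: "G \<in> borel_measurable borel" unfolding G_def by measurable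
  have indep: "(\<integral>\<^sup>+\<omega>. F (S r \<omega>, S (r + h) \<omega>) \<partial>M) = (\<integral>\<^sup>+\<omega>. \<integral>\<^sup>+\<omega>'. F (S r \<omega>, S r \<omega> + S h \<omega>') \<partial>M \<partial>M)"
    if rh: "r \<ge> 0" "h \<ge> 0" for r h
  proof -
    have iv: "indep_var borel (\<lambda>\<omega>. S r \<omega> - S 0 \<omega>) borel (\<lambda>\<omega>. S (r + h) \<omega> - S r \<omega>)"
      using sub rh by (intro independent_increments_indep_var) (auto simp: subordinator_def levy_process_def)
    have st: "distr M borel (\<lambda>\<omega>. S (r + h) \<omega> - S r \<omega>) = distr M borel (\<lambda>\<omega>. S h \<omega> - S 0 \<omega>)"
      using sub rh by (auto simp: subordinator_def levy_process_def stationary_increments_def)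
    have Sm: "S r \<in> borel_measurable M" "S (r + h) \<in> borel_measurable M" "S h \<in> borel_measurable M"
        "S 0 \<in> borel_measurable M"
      using sp(1) rh by auto
    note Sm[measurable]
    have inner: "(\<integral>\<^sup>+\<omega>'. F (x, x + (S (r + h) \<omega>' - S r \<omega>')) \<partial>M) = (\<integral>\<^sup>+\<omega>'. F (x, x + S h \<omega>') \<partial>M)" for x
    proof -
      have "(\<integral>\<^sup>+\<omega>'. F (x, x + (S (r + h) \<omega>' - S r \<omega>')) \<partial>M)
          = (\<integral>\<^sup>+y. F (x, x + y) \<partial>distr M borel (\<lambda>\<omega>. S (r + h) \<omega> - S r \<omega>))"
        by (rule nn_integral_distr[symmetric]) measurable
      also have "\<dots> = (\<integral>\<^sup>+\<omega>'. F (x, x + (S h \<omega>' - S 0 \<omega>')) \<partial>M)"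
        unfolding st by (rule nn_integral_distr) measurable
      also have "\<dots> = (\<integral>\<^sup>+\<omega>'. F (x, x + S h \<omega>') \<partial>M)"
        by (intro nn_integral_cong) (simp add: sp(2))
      finally show ?thesis .
    qed
    have "(\<integral>\<^sup>+\<omega>. F (S r \<omega>, S (r + h) \<omega>) \<partial>M)
        = (\<integral>\<^sup>+\<omega>. (\<lambda>z. F (fst z, fst z + snd z)) (S r \<omega> - S 0 \<omega>, S (r + h) \<omega> - S r \<omega>) \<partial>M)"
      by (intro nn_integral_cong) (simp add: sp(2))
    also have "\<dots> = (\<integral>\<^sup>+\<omega>. \<integral>\<^sup>+\<omega>'. (\<lambda>z. F (fst z, fst z + snd z))
          (S r \<omega> - S 0 \<omega>, S (r + h) \<omega>' - S r \<omega>') \<partial>M \<partial>M)"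
      by (rule nn_integral_indep_var[OF iv]) measurable
    also have "\<dots> = (\<integral>\<^sup>+\<omega>. \<integral>\<^sup>+\<omega>'. F (S r \<omega>, S r \<omega> + S h \<omega>') \<partial>M \<partial>M)"
      by (rule nn_integral_cong) (simp add: sp(2) inner)
    finally show ?thesis .
  qed
  have fixed_r: "(\<integral>\<^sup>+\<omega>. (\<integral>\<^sup>+h\<in>{0..}. F (S r \<omega>, S (r + h) \<omega>) \<partial>lborel) \<partial>M) = (\<integral>\<^sup>+\<omega>. G (S r \<omega>) \<partial>M)"
    if r: "r \<ge> 0" for r
  proof -
    have Sr: "S r \<in> borel_measurable M" using sp(1) r .
    note Sr[measurable]
    have ph: "p (r + h, \<omega>) = S (r + h) \<omega>" if "h \<ge> 0" for h \<omega> using that r by (simp add: p)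
    have "(\<integral>\<^sup>+\<omega>. (\<integral>\<^sup>+h\<in>{0..}. F (S r \<omega>, S (r + h) \<omega>) \<partial>lborel) \<partial>M)
        = (\<integral>\<^sup>+\<omega>. (\<integral>\<^sup>+h\<in>{0..}. F (S r \<omega>, p (r + h, \<omega>)) \<partial>lborel) \<partial>M)"
      by (intro nn_integral_cong) (simp add: indicator_def ph)
    also have "\<dots> = (\<integral>\<^sup>+h. (\<integral>\<^sup>+\<omega>. F (S r \<omega>, p (r + h, \<omega>)) * indicator {0..} h \<partial>M) \<partial>lborel)"
      by (rule lM.Fubini') measurable
    also have "\<dots> = (\<integral>\<^sup>+h\<in>{0..}. (\<integral>\<^sup>+\<omega>. \<integral>\<^sup>+\<omega>'. F (S r \<omega>, S r \<omega> + p (h, \<omega>')) \<partial>M \<partial>M) \<partial>lborel)"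
      by (intro nn_integral_cong) (simp add: indicator_def ph indep r p)
    also have "\<dots> = (\<integral>\<^sup>+h. (\<integral>\<^sup>+\<omega>. (\<integral>\<^sup>+\<omega>'. F (S r \<omega>, S r \<omega> + p (h, \<omega>')) \<partial>M) * indicator {0..} h \<partial>M) \<partial>lborel)"
      by (intro nn_integral_cong) (simp add: indicator_def)
    also have "\<dots> = (\<integral>\<^sup>+\<omega>. (\<integral>\<^sup>+h\<in>{0..}. (\<integral>\<^sup>+\<omega>'. F (S r \<omega>, S r \<omega> + p (h, \<omega>')) \<partial>M) \<partial>lborel) \<partial>M)"
      by (rule lM.Fubini'[symmetric]) measurable
    also have "\<dots> = (\<integral>\<^sup>+\<omega>. G (S r \<omega>) \<partial>M)"
    proof (rule nn_integral_cong)
      fix \<omega>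
      have "(\<integral>\<^sup>+h\<in>{0..}. (\<integral>\<^sup>+\<omega>'. F (S r \<omega>, S r \<omega> + p (h, \<omega>')) \<partial>M) \<partial>lborel)
          = (\<integral>\<^sup>+h\<in>{0..}. (\<integral>\<^sup>+\<omega>'. (\<lambda>y. F (S r \<omega>, S r \<omega> + y)) (S h \<omega>') \<partial>M) \<partial>lborel)"
        by (intro nn_integral_cong) (simp add: indicator_def p)
      also have "\<dots> = G (S r \<omega>)"
        unfolding G_def by (rule stable_potential_measure[OF S \<beta>]) measurable
      finally show "(\<integral>\<^sup>+h\<in>{0..}. (\<integral>\<^sup>+\<omega>'. F (S r \<omega>, S r \<omega> + p (h, \<omega>')) \<partial>M) \<partial>lborel) = G (S r \<omega>)" .
    qed
    finally show ?thesis .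
  qed
  have "(\<integral>\<^sup>+\<omega>. (\<integral>\<^sup>+r\<in>{0..}. (\<integral>\<^sup>+h\<in>{0..}. F (S r \<omega>, S (r + h) \<omega>) \<partial>lborel) \<partial>lborel) \<partial>M)
      = (\<integral>\<^sup>+\<omega>. (\<integral>\<^sup>+r\<in>{0..}. (\<integral>\<^sup>+h\<in>{0..}. F (p (r, \<omega>), p (r + h, \<omega>)) \<partial>lborel) \<partial>lborel) \<partial>M)"
    by (intro nn_integral_cong) (auto simp: indicator_def p intro!: nn_integral_cong)
  also have "\<dots> = (\<integral>\<^sup>+r. (\<integral>\<^sup>+\<omega>. (\<integral>\<^sup>+h\<in>{0..}. F (p (r, \<omega>), p (r + h, \<omega>)) \<partial>lborel) * indicator {0..} r \<partial>M) \<partial>lborel)"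
    by (rule lM.Fubini') measurable
  also have "\<dots> = (\<integral>\<^sup>+r\<in>{0..}. (\<integral>\<^sup>+\<omega>. G (S r \<omega>) \<partial>M) \<partial>lborel)"
  proof (rule nn_integral_cong)
    fix r :: real
    have "(\<integral>\<^sup>+\<omega>. (\<integral>\<^sup>+h\<in>{0..}. F (p (r, \<omega>), p (r + h, \<omega>)) \<partial>lborel) \<partial>M)
        = (\<integral>\<^sup>+\<omega>. (\<integral>\<^sup>+h\<in>{0..}. F (S r \<omega>, S (r + h) \<omega>) \<partial>lborel) \<partial>M)" if "r \<ge> 0"
      using that by (intro nn_integral_cong) (auto simp: indicator_def p)
    then show "(\<integral>\<^sup>+\<omega>. (\<integral>\<^sup>+h\<in>{0..}. F (p (r, \<omega>), p (r + h, \<omega>)) \<partial>lborel) * indicator {0..} r \<partial>M)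
        = (\<integral>\<^sup>+\<omega>. G (S r \<omega>) \<partial>M) * indicator {0..} r"
      using fixed_r[of r] by (cases "r \<ge> 0") simp_all
  qed
  also have "\<dots> = (\<integral>\<^sup>+x\<in>{0<..}. G x * ennreal (x powr (\<beta> - 1) / Gamma \<beta>) \<partial>lborel)"
    by (rule stable_potential_measure[OF S \<beta>]) measurable
  finally show ?thesis unfolding G_def .
qed

lemma stable_potential_atMost:
  assumes \<beta>: "\<beta> > 0" and a: "a \<ge> 0"
  shows "(\<integral>\<^sup>+x\<in>{0<..}. indicator {..a} x * ennreal (x powr (\<beta> - 1) / Gamma \<beta>) \<partial>lborel)
    = ennreal (a powr \<beta> / Gamma (1 + \<beta>))"
proof -
  have G: "Gamma \<beta> > 0" "Gamma (1 + \<beta>) = \<beta> * Gamma \<beta>"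
    using \<beta> Gamma_plus1[of \<beta>] by (auto simp: add.commute nonpos_Ints_def)
  have "(\<integral>\<^sup>+x\<in>{0<..}. indicator {..a} x * ennreal (x powr (\<beta> - 1) / Gamma \<beta>) \<partial>lborel)
      = (\<integral>\<^sup>+x. ennreal (1 / Gamma \<beta>) * (ennreal (x powr (\<beta> - 1)) * indicator {0..a} x) \<partial>lborel)"
    using G(1) by (intro nn_integral_cong) (auto simp: indicator_def ennreal_mult'[symmetric])
  also have "\<dots> = ennreal (1 / Gamma \<beta>) * ennreal (a powr \<beta> / \<beta>)"
    using \<beta> a by (subst nn_integral_cmult) (simp_all add: nn_integral_powr_from_0)
  also have "\<dots> = ennreal (a powr \<beta> / Gamma (1 + \<beta>))"
    using G \<beta> by (simp add: ennreal_mult[symmetric] mult.commute)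
  finally show ?thesis .
qed

text \<open>Besides giving the mean, the finiteness of the expected occupation time shows that almost every
path leaves \<open>[0, a]\<close>: a path that stays below \<open>a\<close> would spend infinite time there.\<close>

lemma expected_occupation_time:
  assumes S: "stable_subordinator M \<beta> S" and \<beta>: "\<beta> > 0" and a: "a \<ge> 0"
  shows "(\<integral>\<^sup>+\<omega>. (\<integral>\<^sup>+r\<in>{0..}. indicator {..a} (S r \<omega>) \<partial>lborel) \<partial>M) = ennreal (a powr \<beta> / Gamma (1 + \<beta>))"
    and "AE \<omega> in M. \<exists>r\<ge>0. S r \<omega> > a"
proof -
  have sub: "subordinator M S" using S by (simp add: stable_subordinator_def)
  interpret lM: pair_sigma_finite lborel M ..
  define p where "p z = S (max 0 (fst z)) (snd z)" for z
  have pb[measurable]: "p \<in> borel_measurable (borel \<Otimes>\<^sub>M M)"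
    unfolding p_def using measurable_joint_process[OF sub] by simp
  have [measurable]: "p \<in> borel_measurable (lborel \<Otimes>\<^sub>M M)"
    using pb by (simp only: measurable_cong_sets[OF sets_pair_measure_cong[OF sets_lborel refl] refl])
  have p: "p (r, \<omega>) = S r \<omega>" if "r \<ge> 0" for r \<omega>
    using that by (simp add: p_def)
  have occ: "(\<integral>\<^sup>+r\<in>{0..}. indicator {..a} (S r \<omega>) \<partial>lborel)
      = (\<integral>\<^sup>+r\<in>{0..}. (indicator {..a} (p (r, \<omega>)) :: ennreal) \<partial>lborel)" for \<omega>
    by (rule nn_integral_cong) (auto simp: indicator_def p)
  have "(\<integral>\<^sup>+\<omega>. (\<integral>\<^sup>+r\<in>{0..}. indicator {..a} (S r \<omega>) \<partial>lborel) \<partial>M)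
      = (\<integral>\<^sup>+r. (\<integral>\<^sup>+\<omega>. indicator {..a} (p (r, \<omega>)) * indicator {0..} r \<partial>M) \<partial>lborel)"
    unfolding occ by (rule lM.Fubini') measurable
  also have "\<dots> = (\<integral>\<^sup>+r\<in>{0..}. (\<integral>\<^sup>+\<omega>. indicator {..a} (S r \<omega>) \<partial>M) \<partial>lborel)"
  proof (rule nn_integral_cong)
    fix r :: real
    show "(\<integral>\<^sup>+\<omega>. indicator {..a} (p (r, \<omega>)) * indicator {0..} r \<partial>M)
        = (\<integral>\<^sup>+\<omega>. indicator {..a} (S r \<omega>) \<partial>M) * (indicator {0..} r :: ennreal)"
      by (cases "r \<ge> 0") (simp_all add: p)
  qed
  also have "\<dots> = (\<integral>\<^sup>+x\<in>{0<..}. indicator {..a} x * ennreal (x powr (\<beta> - 1) / Gamma \<beta>) \<partial>lborel)"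
    by (rule stable_potential_measure[OF S \<beta>]) measurable
  also have "\<dots> = ennreal (a powr \<beta> / Gamma (1 + \<beta>))"
    by (rule stable_potential_atMost[OF \<beta> a])
  finally show total: "(\<integral>\<^sup>+\<omega>. (\<integral>\<^sup>+r\<in>{0..}. indicator {..a} (S r \<omega>) \<partial>lborel) \<partial>M)
      = ennreal (a powr \<beta> / Gamma (1 + \<beta>))" .
  have "AE \<omega> in M. (\<integral>\<^sup>+r\<in>{0..}. indicator {..a} (S r \<omega>) \<partial>lborel) \<noteq> \<infinity>"
    unfolding occ
    by (rule nn_integral_noteq_infinite) (use total in \<open>simp_all add: occ, measurable\<close>)
  then show "AE \<omega> in M. \<exists>r\<ge>0. S r \<omega> > a"
  proof eventually_elim
    case (elim \<omega>)
    show ?case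
    proof (rule ccontr)
      assume "\<not> (\<exists>r\<ge>0. S r \<omega> > a)"
      then have "indicator {..a} (S r \<omega>) * indicator {0..} r = (indicator {0..} r :: ennreal)" for r
        by (auto simp: indicator_def not_less)
      then have "(\<integral>\<^sup>+r\<in>{0..}. indicator {..a} (S r \<omega>) \<partial>lborel) = emeasure lborel {0::real..}"
        by simp
      moreover have "emeasure lborel {0::real..} = \<infinity>"
      proof -
        have "ennreal (real n) \<le> emeasure lborel {0::real..}" for n
          using emeasure_mono[of "{0..real n}" "{0..}" lborel] by simp
        then show ?thesis
          by (metis ennreal_of_nat_eq_real_of_nat ennreal_Ex_less_of_nat infinity_ennreal_def leD less_top)
      qed
      ultimately show False using elim by simp
    qed
  qed
qed

end

section \<open>Moments of the inverse stable subordinator\<close>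

text \<open>The product of the occupation times is a double integral over times \<open>r\<close> (level \<open>a\<close>) and \<open>s\<close> (level
\<open>b\<close>). The part with \<open>s = r + h\<close>, \<open>h \<ge> 0\<close> is the first summand. In the part with \<open>r = s + h\<close>, \<open>h > 0\<close>,
monotonicity makes \<open>x s \<le> x r \<le> a \<le> b\<close>, so that level \<open>b\<close> may be replaced by \<open>a\<close>.\<close>

lemma occupation_times_product:
  fixes x :: "real \<Rightarrow> real"
  assumes mono: "\<And>r t. 0 \<le> r \<Longrightarrow> r \<le> t \<Longrightarrow> x r \<le> x t" and ab: "a \<le> b"
  shows "(\<integral>\<^sup>+r\<in>{0..}. indicator {..a} (x r) \<partial>lborel) * (\<integral>\<^sup>+r\<in>{0..}. indicator {..b} (x r) \<partial>lborel)
    = (\<integral>\<^sup>+r\<in>{0..}. (\<integral>\<^sup>+h\<in>{0..}. indicator {..a} (x r) * indicator {..b} (x (r + h)) \<partial>lborel) \<partial>lborel)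
    + (\<integral>\<^sup>+r\<in>{0..}. (\<integral>\<^sup>+h\<in>{0..}. indicator {..a} (x r) * indicator {..a} (x (r + h)) \<partial>lborel) \<partial>lborel)"
proof -
  \<comment> \<open>The cut-off at \<open>0\<close> in \<open>w\<close> makes \<open>w\<close> monotone, hence measurable, on the whole line.\<close>
  define w where "w r = x (max 0 r)" for r
  have "mono w" by (intro monoI) (auto simp: w_def intro: mono)
  then have [measurable]: "w \<in> borel_measurable borel" by (rule borel_measurable_mono)
  define A B :: "real \<Rightarrow> ennreal"
    where "A r = indicator {..a} (w r) * indicator {0..} r"
      and "B r = indicator {..b} (w r) * indicator {0..} r" for r
  have [measurable]: "A \<in> borel_measurable borel" "B \<in> borel_measurable borel"
    unfolding A_def B_def by measurable
  have AB: "indicator {..a} (x r) * indicator {0..} r = A r" "indicator {..b} (x r) * indicator {0..} r = B r" for r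
    by (auto simp: A_def B_def w_def indicator_def)
  have "(\<integral>\<^sup>+r. A r \<partial>lborel) * (\<integral>\<^sup>+s. B s \<partial>lborel) = (\<integral>\<^sup>+r. (\<integral>\<^sup>+s. A r * B s \<partial>lborel) \<partial>lborel)"
    by (simp add: nn_integral_cmult nn_integral_multc)
  also have "\<dots> = (\<integral>\<^sup>+r. (\<integral>\<^sup>+s. A r * B s * indicator {r..} s \<partial>lborel)
      + (\<integral>\<^sup>+s. A r * B s * indicator {..<r} s \<partial>lborel) \<partial>lborel)"
  proof (rule nn_integral_cong)
    fix r :: real
    have "(\<integral>\<^sup>+s. A r * B s \<partial>lborel)
        = (\<integral>\<^sup>+s. A r * B s * indicator {r..} s + A r * B s * indicator {..<r} s \<partial>lborel)"
      by (intro nn_integral_cong) (auto simp: indicator_def)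
    then show "(\<integral>\<^sup>+s. A r * B s \<partial>lborel) = (\<integral>\<^sup>+s. A r * B s * indicator {r..} s \<partial>lborel)
      + (\<integral>\<^sup>+s. A r * B s * indicator {..<r} s \<partial>lborel)"
      by (simp add: nn_integral_add)
  qed
  also have "\<dots> = (\<integral>\<^sup>+r. (\<integral>\<^sup>+s. A r * B s * (if r \<le> s then 1 else 0) \<partial>lborel) \<partial>lborel)
      + (\<integral>\<^sup>+r. (\<integral>\<^sup>+s. A r * B s * (if s < r then 1 else 0) \<partial>lborel) \<partial>lborel)"
    by (subst nn_integral_add[symmetric]) (measurable, simp add: indicator_def of_bool_def)
  also have "(\<integral>\<^sup>+r. (\<integral>\<^sup>+s. A r * B s * (if s < r then 1 else 0) \<partial>lborel) \<partial>lborel)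
      = (\<integral>\<^sup>+s. (\<integral>\<^sup>+r. A r * B s * (if s < r then 1 else 0) \<partial>lborel) \<partial>lborel)"
    by (rule lborel_pair.Fubini') measurable
  also have "\<dots> = (\<integral>\<^sup>+r\<in>{0..}. (\<integral>\<^sup>+h\<in>{0..}. indicator {..a} (x r) * indicator {..a} (x (r + h)) \<partial>lborel) \<partial>lborel)"
  proof (rule nn_integral_cong)
    fix s :: real
    have "(\<integral>\<^sup>+r. A r * B s * (if s < r then 1 else 0) \<partial>lborel)
        = ennreal \<bar>1\<bar> * (\<integral>\<^sup>+h. A (s + 1 * h) * B s * (if s < s + 1 * h then 1 else 0) \<partial>lborel)"
      by (rule nn_integral_real_affine) auto
    also have "\<dots> = (\<integral>\<^sup>+h. A (s + h) * B s * (if 0 < h then 1 else 0) \<partial>lborel)"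
      by simp
    also have "\<dots> = (\<integral>\<^sup>+h. indicator {..a} (x s) * indicator {..a} (x (s + h)) * indicator {0..} h
        * indicator {0..} s \<partial>lborel)"
    proof (rule nn_integral_cong_AE)
      have "AE h in lborel. h \<noteq> (0::real)" by (rule AE_lborel_singleton)
      then show "AE h in lborel. A (s + h) * B s * (if 0 < h then 1 else 0)
          = indicator {..a} (x s) * indicator {..a} (x (s + h)) * indicator {0..} h * (indicator {0..} s :: ennreal)"
      proof eventually_elim
        case (elim h)
        have "x s \<le> x (s + h)" if "s \<ge> 0" "h \<ge> 0" using mono that by simp
        then show ?case using elim ab by (auto simp: A_def B_def w_def indicator_def)
      qed
    qed
    also have "\<dots> = (\<integral>\<^sup>+h\<in>{0..}. indicator {..a} (x s) * indicator {..a} (x (s + h)) \<partial>lborel) * indicator {0..} s"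
      by (cases "s \<ge> 0") simp_all
    finally show "(\<integral>\<^sup>+r. A r * B s * (if s < r then 1 else 0) \<partial>lborel)
        = (\<integral>\<^sup>+h\<in>{0..}. indicator {..a} (x s) * indicator {..a} (x (s + h)) \<partial>lborel) * indicator {0..} s" .
  qed
  also have "(\<integral>\<^sup>+r. (\<integral>\<^sup>+s. A r * B s * (if r \<le> s then 1 else 0) \<partial>lborel) \<partial>lborel)
      = (\<integral>\<^sup>+r\<in>{0..}. (\<integral>\<^sup>+h\<in>{0..}. indicator {..a} (x r) * indicator {..b} (x (r + h)) \<partial>lborel) \<partial>lborel)"
  proof (rule nn_integral_cong)
    fix r :: real
    have "(\<integral>\<^sup>+s. A r * B s * (if r \<le> s then 1 else 0) \<partial>lborel)
        = ennreal \<bar>1\<bar> * (\<integral>\<^sup>+h. A r * B (r + 1 * h) * (if r \<le> r + 1 * h then 1 else 0) \<partial>lborel)"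
      by (rule nn_integral_real_affine) auto
    also have "\<dots> = (\<integral>\<^sup>+h. indicator {..a} (x r) * indicator {..b} (x (r + h)) * indicator {0..} h
        * indicator {0..} r \<partial>lborel)"
      by (simp, rule nn_integral_cong) (auto simp: A_def B_def w_def indicator_def)
    also have "\<dots> = (\<integral>\<^sup>+h\<in>{0..}. indicator {..a} (x r) * indicator {..b} (x (r + h)) \<partial>lborel) * indicator {0..} r"
      by (cases "r \<ge> 0") simp_all
    finally show "(\<integral>\<^sup>+s. A r * B s * (if r \<le> s then 1 else 0) \<partial>lborel)
        = (\<integral>\<^sup>+h\<in>{0..}. indicator {..a} (x r) * indicator {..b} (x (r + h)) \<partial>lborel) * indicator {0..} r" .
  qed
  finally show ?thesis unfolding AB .
qed

context prob_space begin

text \<open>From position \<open>x \<le> a\<close> the process stays below \<open>b\<close> for an expected time \<open>(b - x)\<^sup>\<beta>/\<Gamma>(1 + \<beta>)\<close>;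
integrating this against the potential density over \<open>x \<in> [0, a]\<close> gives the beta integral.\<close>

lemma stable_potential_two_levels:
  assumes S: "stable_subordinator M \<beta> S" and \<beta>: "\<beta> > 0" and ab: "0 \<le> a" "a \<le> b"
  shows "(\<integral>\<^sup>+\<omega>. (\<integral>\<^sup>+r\<in>{0..}. (\<integral>\<^sup>+h\<in>{0..}. indicator {..a} (S r \<omega>) * indicator {..b} (S (r + h) \<omega>) \<partial>lborel) \<partial>lborel) \<partial>M)
    = ennreal (\<beta> / (Gamma (1 + \<beta>))\<^sup>2 * (b powr (2 * \<beta>) * incomplete_Beta \<beta> (1 + \<beta>) (a / b)))"
proof -
  have G: "Gamma \<beta> > 0" "Gamma (1 + \<beta>) = \<beta> * Gamma \<beta>"
    using \<beta> Gamma_plus1[of \<beta>] by (auto simp: add.commute nonpos_Ints_def)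
  define c where "c = 1 / (Gamma (1 + \<beta>) * Gamma \<beta>)"
  have c: "c > 0" using G \<beta> by (simp add: c_def)
  have "(\<integral>\<^sup>+\<omega>. (\<integral>\<^sup>+r\<in>{0..}. (\<integral>\<^sup>+h\<in>{0..}. indicator {..a} (S r \<omega>) * indicator {..b} (S (r + h) \<omega>) \<partial>lborel) \<partial>lborel) \<partial>M)
    = (\<integral>\<^sup>+x\<in>{0<..}. (\<integral>\<^sup>+y\<in>{0<..}. indicator {..a} x * indicator {..b} (x + y) * ennreal (y powr (\<beta> - 1) / Gamma \<beta>) \<partial>lborel)
         * ennreal (x powr (\<beta> - 1) / Gamma \<beta>) \<partial>lborel)"
    using stable_potential_two_times[OF S \<beta>, of "\<lambda>z. indicator {..a} (fst z) * indicator {..b} (snd z)"] by simp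
  also have "\<dots> = (\<integral>\<^sup>+x. ennreal c * (indicator {..a} x * ennreal ((b - x) powr \<beta>) * ennreal (x powr (\<beta> - 1))
      * indicator {0<..} x) \<partial>lborel)"
  proof (rule nn_integral_cong)
    fix x :: real
    show "(\<integral>\<^sup>+y\<in>{0<..}. indicator {..a} x * indicator {..b} (x + y) * ennreal (y powr (\<beta> - 1) / Gamma \<beta>) \<partial>lborel)
         * ennreal (x powr (\<beta> - 1) / Gamma \<beta>) * indicator {0<..} x
       = ennreal c * (indicator {..a} x * ennreal ((b - x) powr \<beta>) * ennreal (x powr (\<beta> - 1)) * indicator {0<..} x)"
    proof (cases "x \<le> a \<and> x > 0")
      case True
      have "(\<integral>\<^sup>+y\<in>{0<..}. indicator {..a} x * indicator {..b} (x + y) * ennreal (y powr (\<beta> - 1) / Gamma \<beta>) \<partial>lborel)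
          = (\<integral>\<^sup>+y\<in>{0<..}. indicator {..b - x} y * ennreal (y powr (\<beta> - 1) / Gamma \<beta>) \<partial>lborel)"
        using True by (intro nn_integral_cong) (auto simp: indicator_def)
      also have "\<dots> = ennreal ((b - x) powr \<beta> / Gamma (1 + \<beta>))"
        using True ab by (intro stable_potential_atMost[OF \<beta>]) simp
      finally show ?thesis
        using True G \<beta> by (simp add: c_def ennreal_mult[symmetric])
    next
      case False
      then show ?thesis by (auto simp: indicator_def)
    qed
  qed
  also have "\<dots> = ennreal c * ennreal (b powr (2 * \<beta>) * incomplete_Beta \<beta> (1 + \<beta>) (a / b))"
    by (subst nn_integral_cmult) (auto simp only: nn_integral_Beta_kernel[OF \<beta> ab], measurable)
  also have "c = \<beta> / (Gamma (1 + \<beta>))\<^sup>2"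
    using G \<beta> by (simp add: c_def power2_eq_square)
  finally show ?thesis
    using \<beta> by (subst ennreal_mult') simp_all
qed

text \<open>The last clause holds almost surely only: on the null event where \<open>S\<close> never exceeds \<open>b\<close>, the
infimum in the definition of the inverse is taken over the empty set.\<close>

lemma inverse_stable_moments:
  assumes S: "stable_subordinator M \<beta> S" and \<beta>: "\<beta> > 0" and ab: "0 \<le> a" "a \<le> b"
  shows "(\<integral>\<^sup>+\<omega>. ennreal (inverse_process S a \<omega>) \<partial>M) = ennreal (a powr \<beta> / Gamma (1 + \<beta>))"
    and "(\<integral>\<^sup>+\<omega>. ennreal (inverse_process S a \<omega>) * ennreal (inverse_process S b \<omega>) \<partial>M)
      = ennreal (\<beta> / (Gamma (1 + \<beta>))\<^sup>2
          * (a powr (2 * \<beta>) * Beta \<beta> (1 + \<beta>) + b powr (2 * \<beta>) * incomplete_Beta \<beta> (1 + \<beta>) (a / b)))"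
    and "AE \<omega> in M. 0 \<le> inverse_process S a \<omega> \<and> inverse_process S a \<omega> \<le> inverse_process S b \<omega>"
proof -
  have sub: "subordinator M S" using S by (simp add: stable_subordinator_def)
  note sp = subordinator_properties[OF sub]
  have ex: "AE \<omega> in M. \<exists>r\<ge>0. S r \<omega> > b"
    using ab by (intro expected_occupation_time(2)[OF S \<beta>]) simp
  have occ: "AE \<omega> in M. ennreal (inverse_process S c \<omega>) = (\<integral>\<^sup>+r\<in>{0..}. indicator {..c} (S r \<omega>) \<partial>lborel)
      \<and> inverse_process S c \<omega> \<ge> 0" if cb: "c \<le> b" for c
    using ex AE_space
  proof eventually_elim
    case (elim \<omega>)
    then have "\<exists>r\<ge>0. S r \<omega> > c" using cb le_less_trans by blast
    from occupation_time_below_level[of S \<omega> c, OF sp(3)[OF elim(2)] this] show ?case by simp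
  qed
  have "(\<integral>\<^sup>+\<omega>. ennreal (inverse_process S a \<omega>) \<partial>M)
      = (\<integral>\<^sup>+\<omega>. (\<integral>\<^sup>+r\<in>{0..}. indicator {..a} (S r \<omega>) \<partial>lborel) \<partial>M)"
    by (rule nn_integral_cong_AE, use occ[OF ab(2)] in eventually_elim) simp
  then show "(\<integral>\<^sup>+\<omega>. ennreal (inverse_process S a \<omega>) \<partial>M) = ennreal (a powr \<beta> / Gamma (1 + \<beta>))"
    using expected_occupation_time(1)[OF S \<beta> ab(1)] by simp
  show "AE \<omega> in M. 0 \<le> inverse_process S a \<omega> \<and> inverse_process S a \<omega> \<le> inverse_process S b \<omega>"
    using ex occ[OF ab(2)] by eventually_elim (simp add: inverse_process_mono ab(2))
  define J where "J c \<omega> = (\<integral>\<^sup>+r\<in>{0..}. (\<integral>\<^sup>+h\<in>{0..}. indicator {..a} (S r \<omega>) * indicator {..c} (S (r + h) \<omega>) \<partial>lborel) \<partial>lborel)"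
    for c \<omega>
  define p where "p z = S (max 0 (fst z)) (snd z)" for z
  have pb: "p \<in> borel_measurable (borel \<Otimes>\<^sub>M M)"
    unfolding p_def using measurable_joint_process[OF sub] by simp
  have [measurable]: "p \<in> borel_measurable (lborel \<Otimes>\<^sub>M M)"
    using pb by (simp only: measurable_cong_sets[OF sets_pair_measure_cong[OF sets_lborel refl] refl])
  note pb[measurable]
  have "J c = (\<lambda>\<omega>. \<integral>\<^sup>+r\<in>{0..}. (\<integral>\<^sup>+h\<in>{0..}. indicator {..a} (p (r, \<omega>)) * indicator {..c} (p (r + h, \<omega>)) \<partial>lborel) \<partial>lborel)" for c
  proof
    fix \<omega>
    show "J c \<omega> = (\<integral>\<^sup>+r\<in>{0..}. (\<integral>\<^sup>+h\<in>{0..}. indicator {..a} (p (r, \<omega>)) * indicator {..c} (p (r + h, \<omega>)) \<partial>lborel) \<partial>lborel)"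
      unfolding J_def
    proof (rule nn_integral_cong)
      fix r :: real
      have "(\<integral>\<^sup>+h\<in>{0..}. indicator {..a} (S r \<omega>) * indicator {..c} (S (r + h) \<omega>) \<partial>lborel)
          = (\<integral>\<^sup>+h\<in>{0..}. (indicator {..a} (p (r, \<omega>)) * indicator {..c} (p (r + h, \<omega>)) :: ennreal) \<partial>lborel)" if "r \<ge> 0"
        using that by (intro nn_integral_cong) (auto simp: p_def indicator_def)
      then show "(\<integral>\<^sup>+h\<in>{0..}. indicator {..a} (S r \<omega>) * indicator {..c} (S (r + h) \<omega>) \<partial>lborel) * indicator {0..} r
          = (\<integral>\<^sup>+h\<in>{0..}. (indicator {..a} (p (r, \<omega>)) * indicator {..c} (p (r + h, \<omega>)) :: ennreal) \<partial>lborel) * indicator {0..} r"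
        by (cases "r \<ge> 0") simp_all
    qed
  qed
  then have [measurable]: "J c \<in> borel_measurable M" for c
    by simp
  have "(\<integral>\<^sup>+\<omega>. ennreal (inverse_process S a \<omega>) * ennreal (inverse_process S b \<omega>) \<partial>M) = (\<integral>\<^sup>+\<omega>. J b \<omega> + J a \<omega> \<partial>M)"
  proof (rule nn_integral_cong_AE, use occ[OF ab(2)] occ[OF order_refl] AE_space in eventually_elim)
    case (elim \<omega>)
    show ?case
      using elim occupation_times_product[of "\<lambda>r. S r \<omega>" a b, OF sp(3)[OF elim(3)] ab(2)]
      by (simp add: J_def)
  qed
  also have "\<dots> = (\<integral>\<^sup>+\<omega>. J b \<omega> \<partial>M) + (\<integral>\<^sup>+\<omega>. J a \<omega> \<partial>M)"
    by (rule nn_integral_add) measurable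
  also have "(\<integral>\<^sup>+\<omega>. J b \<omega> \<partial>M) = ennreal (\<beta> / (Gamma (1 + \<beta>))\<^sup>2 * (b powr (2 * \<beta>) * incomplete_Beta \<beta> (1 + \<beta>) (a / b)))"
    unfolding J_def by (rule stable_potential_two_levels[OF S \<beta> ab])
  also have "(\<integral>\<^sup>+\<omega>. J a \<omega> \<partial>M) = ennreal (\<beta> / (Gamma (1 + \<beta>))\<^sup>2 * (a powr (2 * \<beta>) * incomplete_Beta \<beta> (1 + \<beta>) (a / a)))"
    unfolding J_def by (rule stable_potential_two_levels[OF S \<beta> ab(1) order_refl])
  also have "a powr (2 * \<beta>) * incomplete_Beta \<beta> (1 + \<beta>) (a / a) = a powr (2 * \<beta>) * Beta \<beta> (1 + \<beta>)"
    using \<beta> by (cases "a = 0") (simp_all add: incomplete_Beta_one)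
  also have "ennreal (\<beta> / (Gamma (1 + \<beta>))\<^sup>2 * (b powr (2 * \<beta>) * incomplete_Beta \<beta> (1 + \<beta>) (a / b)))
      + ennreal (\<beta> / (Gamma (1 + \<beta>))\<^sup>2 * (a powr (2 * \<beta>) * Beta \<beta> (1 + \<beta>)))
    = ennreal (\<beta> / (Gamma (1 + \<beta>))\<^sup>2
          * (a powr (2 * \<beta>) * Beta \<beta> (1 + \<beta>) + b powr (2 * \<beta>) * incomplete_Beta \<beta> (1 + \<beta>) (a / b)))"
    using \<beta> Beta_nonneg[of \<beta> "1 + \<beta>"]
    by (subst ennreal_plus[symmetric])
       (auto simp: incomplete_Beta_nonneg distrib_left add.commute intro!: mult_nonneg_nonneg divide_nonneg_nonneg)
  finally show "(\<integral>\<^sup>+\<omega>. ennreal (inverse_process S a \<omega>) * ennreal (inverse_process S b \<omega>) \<partial>M)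
      = ennreal (\<beta> / (Gamma (1 + \<beta>))\<^sup>2
          * (a powr (2 * \<beta>) * Beta \<beta> (1 + \<beta>) + b powr (2 * \<beta>) * incomplete_Beta \<beta> (1 + \<beta>) (a / b)))" .
qed

end

section \<open>Moments of the fractional Poisson process\<close>

text \<open>Since \<open>N\<close> is integer-valued and right-continuous, it is constant on some \<open>[e, c)\<close> with
\<open>e = E\<^sub>\<beta>(t)\<close>. If \<open>r < c\<close> is a time with \<open>S(r) > t\<close>, then \<open>e \<le> E\<^sub>\<beta>(s) \<le> r < c\<close> for \<open>t \<le> s < S(r)\<close>. The
statement is needed for every outcome, not just almost surely, so that the composition with \<open>M\<close> is
measurable.\<close>

lemma fractional_poisson_right_continuous:
  assumes N: "mono_on {0..} (\<lambda>t. N t \<omega>)" and N_rc: "cadlag_path (\<lambda>t. real (N t \<omega>))"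
    and t: "t \<ge> 0"
  shows "((\<lambda>s. real (fractional_poisson N S s \<omega>)) \<longlongrightarrow> real (fractional_poisson N S t \<omega>)) (at_right t)"
proof -
  have "\<forall>\<^sub>F s in at_right t. fractional_poisson N S s \<omega> = fractional_poisson N S t \<omega>"
  proof (cases "\<exists>r\<ge>0. S r \<omega> > t")
    case False
    \<comment> \<open>Here \<open>E\<^sub>\<beta>\<close> has the constant, arbitrary value \<open>Inf {}\<close> from time \<open>t\<close> on.\<close>
    have "{r. 0 \<le> r \<and> S r \<omega> > s} = {}" if "s \<ge> t" for s
      using False that by force
    then have "inverse_process S s \<omega> = inverse_process S t \<omega>" if "s > t" for s
      unfolding inverse_process_def using that by (simp only: less_imp_le order_refl)
    then show ?thesis
      by (auto simp: eventually_at_right_field fractional_poisson_def intro!: exI[of _ "t + 1"])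
  next
    case True
    define A where "A s = {r. 0 \<le> r \<and> S r \<omega> > s}" for s
    define e where "e = inverse_process S t \<omega>"
    have e: "e = Inf (A t)" by (simp add: e_def inverse_process_def A_def)
    have A: "A t \<noteq> {}" "bdd_below (A s)" for s
      using True by (auto simp: A_def intro!: bdd_belowI[of _ 0])
    have "e \<ge> 0" unfolding e using A by (intro cInf_greatest) (auto simp: A_def)
    then have "((\<lambda>x. real (N x \<omega>)) \<longlongrightarrow> real (N e \<omega>)) (at_right e)"
      using N_rc by (auto simp: cadlag_path_def continuous_within)
    then have "\<forall>\<^sub>F x in at_right e. dist (real (N x \<omega>)) (real (N e \<omega>)) < 1"
      by (rule tendstoD) simp
    then obtain c where c: "c > e" "\<And>x. e < x \<Longrightarrow> x < c \<Longrightarrow> dist (real (N x \<omega>)) (real (N e \<omega>)) < 1"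
      by (auto simp: eventually_at_right_field)
    have const: "N x \<omega> = N e \<omega>" if "e \<le> x" "x < c" for x
    proof (cases "x = e")
      case False
      then show ?thesis using c(2)[of x] that by (auto simp: dist_real_def)
    qed simp
    obtain r where r: "r \<in> A t" "r < c" using cInf_lessD[OF A(1)] c(1) e by auto
    have "fractional_poisson N S s \<omega> = fractional_poisson N S t \<omega>" if s: "t < s" "s < S r \<omega>" for s
    proof -
      have "A s \<subseteq> A t" "r \<in> A s" using s r by (auto simp: A_def)
      then have "Inf (A t) \<le> Inf (A s)" "Inf (A s) \<le> r"
        using A by (auto intro: cInf_superset_mono cInf_lower)
      then have "N (Inf (A s)) \<omega> = N e \<omega>" using r e by (intro const) auto
      then show ?thesis unfolding fractional_poisson_def inverse_process_def A_def[symmetric] e .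
    qed
    moreover have "t < S r \<omega>" using r by (simp add: A_def)
    ultimately show ?thesis by (auto simp: eventually_at_right_field)
  qed
  then show ?thesis
    by (rule tendsto_eventually[OF eventually_mono]) simp
qed

context prob_space begin

lemma independent_processes_sym:
  assumes "independent_processes M X Y"
  shows "independent_processes M Y X"
proof -
  have "indep_var A V B U" if "indep_var B U A V" for A B :: "(real \<Rightarrow> real) measure" and U V
    using that unfolding indep_var_eq indep_sets2_eq
  proof (elim conjE, intro conjI ballI)
    fix x y
    assume x: "x \<in> sigma_sets (space M) {V -` C \<inter> space M |C. C \<in> sets A}"
      and y: "y \<in> sigma_sets (space M) {U -` C \<inter> space M |C. C \<in> sets B}"
      and all: "\<forall>a\<in>sigma_sets (space M) {U -` C \<inter> space M |C. C \<in> sets B}.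
        \<forall>b\<in>sigma_sets (space M) {V -` C \<inter> space M |C. C \<in> sets A}. prob (a \<inter> b) = prob a * prob b"
    show "prob (x \<inter> y) = prob x * prob y"
      using all[rule_format, OF y x] by (simp only: Int_commute[of x] mult.commute[of "prob x"])
  qed
  then show ?thesis using assms by (simp add: independent_processes_def)
qed

lemma independent_processes_measurable:
  assumes "independent_processes M X Y" "t \<ge> 0"
  shows "X t \<in> borel_measurable M" "Y t \<in> borel_measurable M"
proof -
  let ?B = "Pi\<^sub>M {0..} (\<lambda>_. borel) :: (real \<Rightarrow> real) measure"
  have "Z t \<in> borel_measurable M" if "(\<lambda>\<omega>. \<lambda>t\<in>{0..}. Z t \<omega>) \<in> measurable M ?B" for Z
    using measurable_compose[OF that measurable_component_singleton[of t]] assms(2) by simp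
  moreover have "(\<lambda>\<omega>. \<lambda>t\<in>{0..}. X t \<omega>) \<in> measurable M ?B" "(\<lambda>\<omega>. \<lambda>t\<in>{0..}. Y t \<omega>) \<in> measurable M ?B"
    using assms(1) unfolding independent_processes_def by (blast dest: indep_var_rv1 indep_var_rv2)+
  ultimately show "X t \<in> borel_measurable M" "Y t \<in> borel_measurable M" by blast+
qed

text \<open>The Poisson moments at the frozen times \<open>x = E\<^sub>\<beta>(a) \<le> y = E\<^sub>\<beta>(b)\<close> are linear in \<open>x\<close> and \<open>xy\<close>, so the
moments of the inverse stable subordinator can be inserted.\<close>

lemma fractional_poisson_moments:
  fixes lam \<beta> :: real
  assumes N: "poisson_process M lam N" and S: "stable_subordinator M \<beta> S"
    and ind: "independent_processes M (\<lambda>t \<omega>. real (N t \<omega>)) (inverse_process S)"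
    and \<beta>: "\<beta> > 0" and lam: "lam > 0" and ab: "0 \<le> a" "a \<le> b"
  defines "q \<equiv> lam / Gamma (1 + \<beta>)"
  shows "(\<integral>\<^sup>+\<omega>. ennreal (real (fractional_poisson N S a \<omega>)) \<partial>M) = ennreal (q * a powr \<beta>)"
    and "(\<integral>\<^sup>+\<omega>. ennreal (real (fractional_poisson N S a \<omega>) * real (fractional_poisson N S b \<omega>)) \<partial>M)
      = ennreal (q * a powr \<beta> + q\<^sup>2 * \<beta> *
          (a powr (2 * \<beta>) * Beta \<beta> (1 + \<beta>) + b powr (2 * \<beta>) * incomplete_Beta \<beta> (1 + \<beta>) (a / b)))"
proof -
  let ?E = "inverse_process S"
  note mom = inverse_stable_moments[OF S \<beta> ab]
  have b: "b \<ge> 0" using ab by simp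
  have Em[measurable]: "?E a \<in> borel_measurable M" "?E b \<in> borel_measurable M"
    using independent_processes_measurable(2)[OF ind] ab b by auto
  have N_rc: "((\<lambda>s. real (N s \<omega>)) \<longlongrightarrow> real (N t \<omega>)) (at_right t)" if "\<omega> \<in> space M" "t \<ge> 0" for \<omega> t
    using N that by (auto simp: poisson_process_def cadlag_path_def continuous_within)
  have pos: "AE \<omega> in M. ?E a \<omega> \<ge> 0" "AE \<omega> in M. ?E b \<omega> \<ge> 0"
    by (use mom(3) in eventually_elim, simp)+
  note comp = nn_integral_independent_composition[OF independent_processes_sym[OF ind] N_rc]
  have q: "q > 0" using lam \<beta> Gamma_real_pos[of "1 + \<beta>"] by (simp add: q_def)
  have "(\<integral>\<^sup>+\<omega>. ennreal (real (fractional_poisson N S a \<omega>)) \<partial>M)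
      = (\<integral>\<^sup>+\<omega>. \<integral>\<^sup>+\<omega>'. ennreal (real (N (?E a \<omega>) \<omega>')) \<partial>M \<partial>M)"
    using comp[OF _ _ ab(1) ab(1) pos(1) pos(1), of "\<lambda>z. ennreal (fst z)"]
    by (simp add: fractional_poisson_def)
  also have "\<dots> = (\<integral>\<^sup>+\<omega>. ennreal lam * ennreal (?E a \<omega>) \<partial>M)"
    by (rule nn_integral_cong_AE, use pos(1) in eventually_elim)
       (simp add: poisson_process_moments(1)[OF N _ order_refl] ennreal_mult' lam less_imp_le)
  also have "\<dots> = ennreal (q * a powr \<beta>)"
    using lam by (subst nn_integral_cmult) (simp_all add: mom(1) ennreal_mult'[symmetric] q_def)
  finally show "(\<integral>\<^sup>+\<omega>. ennreal (real (fractional_poisson N S a \<omega>)) \<partial>M) = ennreal (q * a powr \<beta>)" .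
  have "(\<integral>\<^sup>+\<omega>. ennreal (real (fractional_poisson N S a \<omega>) * real (fractional_poisson N S b \<omega>)) \<partial>M)
      = (\<integral>\<^sup>+\<omega>. \<integral>\<^sup>+\<omega>'. ennreal (real (N (?E a \<omega>) \<omega>') * real (N (?E b \<omega>) \<omega>')) \<partial>M \<partial>M)"
    using comp[OF _ _ ab(1) b pos, of "\<lambda>z. ennreal (fst z * snd z)"]
    by (simp add: fractional_poisson_def)
  also have "\<dots> = (\<integral>\<^sup>+\<omega>. ennreal lam * ennreal (?E a \<omega>) + ennreal (lam\<^sup>2) * (ennreal (?E a \<omega>) * ennreal (?E b \<omega>)) \<partial>M)"
  proof (rule nn_integral_cong_AE, use mom(3) in eventually_elim)
    case (elim \<omega>)
    then show ?case
      using poisson_process_moments(2)[OF N, of "?E a \<omega>" "?E b \<omega>"] lam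
      by (simp add: ennreal_mult mult.assoc)
  qed
  also have "\<dots> = ennreal lam * (\<integral>\<^sup>+\<omega>. ennreal (?E a \<omega>) \<partial>M)
      + ennreal (lam\<^sup>2) * (\<integral>\<^sup>+\<omega>. ennreal (?E a \<omega>) * ennreal (?E b \<omega>) \<partial>M)"
    by (subst nn_integral_add) (simp_all add: nn_integral_cmult)
  also have "\<dots> = ennreal (q * a powr \<beta> + q\<^sup>2 * \<beta> *
          (a powr (2 * \<beta>) * Beta \<beta> (1 + \<beta>) + b powr (2 * \<beta>) * incomplete_Beta \<beta> (1 + \<beta>) (a / b)))"
  proof -
    let ?K = "a powr (2 * \<beta>) * Beta \<beta> (1 + \<beta>) + b powr (2 * \<beta>) * incomplete_Beta \<beta> (1 + \<beta>) (a / b)"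
    have K: "?K \<ge> 0"
      using \<beta> Beta_nonneg[of \<beta> "1 + \<beta>"]
      by (intro add_nonneg_nonneg mult_nonneg_nonneg) (simp_all add: incomplete_Beta_nonneg)
    have "ennreal lam * ennreal (a powr \<beta> / Gamma (1 + \<beta>)) = ennreal (q * a powr \<beta>)"
      using lam by (simp add: ennreal_mult'[symmetric] q_def)
    moreover have "ennreal (lam\<^sup>2) * ennreal (\<beta> / (Gamma (1 + \<beta>))\<^sup>2 * ?K) = ennreal (q\<^sup>2 * \<beta> * ?K)"
      by (subst ennreal_mult'[symmetric]) (simp_all add: q_def power_divide mult.assoc)
    moreover have "q\<^sup>2 * \<beta> * ?K \<ge> 0" using K \<beta> by simp
    ultimately show ?thesis unfolding mom(1,2) using q by simp
  qed
  finally show "(\<integral>\<^sup>+\<omega>. ennreal (real (fractional_poisson N S a \<omega>) * real (fractional_poisson N S b \<omega>)) \<partial>M)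
      = ennreal (q * a powr \<beta> + q\<^sup>2 * \<beta> *
          (a powr (2 * \<beta>) * Beta \<beta> (1 + \<beta>) + b powr (2 * \<beta>) * incomplete_Beta \<beta> (1 + \<beta>) (a / b)))" .
qed

end

section \<open>Fractional moments of the Mittag-Leffler subordinator\<close>

context prob_space begin

text \<open>Fractional moments can be read off the Laplace transform alone, even when the law has no closed
form: average the representation of \<open>x\<^sup>b\<close> as a mixture of the functions \<open>1 - exp(-ux)\<close>.\<close>

lemma nn_integral_powr_via_Laplace:
  fixes b :: real
  assumes X[measurable]: "X \<in> borel_measurable M" and pos: "\<And>\<omega>. \<omega> \<in> space M \<Longrightarrow> X \<omega> \<ge> 0"
    and b: "0 < b" "b < 1"
  shows "(\<integral>\<^sup>+\<omega>. ennreal (X \<omega> powr b) \<partial>M) = ennreal (b / Gamma (1 - b)) *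
    (\<integral>\<^sup>+u\<in>{0<..}. ennreal ((1 - expectation (\<lambda>\<omega>. exp (- u * X \<omega>))) * u powr (- b - 1)) \<partial>lborel)"
proof -
  interpret lM: pair_sigma_finite lborel M ..
  define K where "K = b / Gamma (1 - b)"
  have G: "Gamma (1 - b) > 0" using b by (intro Gamma_real_pos) simp
  then have G0: "Gamma (1 - b) \<noteq> 0" by (rule less_imp_neq[symmetric])
  have K: "K > 0" using G b by (simp add: K_def)
  have "(\<integral>\<^sup>+\<omega>. ennreal (X \<omega> powr b) \<partial>M)
      = (\<integral>\<^sup>+\<omega>. ennreal K * (\<integral>\<^sup>+u. ennreal ((1 - exp (- u * X \<omega>)) * u powr (- b - 1)) * indicator {0<..} u \<partial>lborel) \<partial>M)"
  proof (rule nn_integral_cong)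
    fix \<omega> assume "\<omega> \<in> space M"
    have "(\<integral>\<^sup>+u\<in>{0<..}. ennreal ((1 - exp (- u * X \<omega>)) * u powr (- b - 1)) \<partial>lborel)
        = (\<integral>\<^sup>+u\<in>{0<..}. ennreal ((1 - exp (- X \<omega> * u powr 1)) * u powr (- b - 1)) \<partial>lborel)"
      by (intro nn_integral_cong) (simp add: indicator_def mult.commute)
    also have "\<dots> = ennreal (Gamma (1 - b / 1) / b * X \<omega> powr (b / 1))"
      using b pos[OF \<open>\<omega> \<in> space M\<close>] by (intro nn_integral_one_minus_exp_powr) auto
    finally show "ennreal (X \<omega> powr b)
      = ennreal K * (\<integral>\<^sup>+u\<in>{0<..}. ennreal ((1 - exp (- u * X \<omega>)) * u powr (- b - 1)) \<partial>lborel)"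
      using G b by (simp add: K_def ennreal_mult'[symmetric] G0)
  qed
  also have "\<dots> = ennreal K * (\<integral>\<^sup>+\<omega>. (\<integral>\<^sup>+u. ennreal ((1 - exp (- u * X \<omega>)) * u powr (- b - 1)) * indicator {0<..} u \<partial>lborel) \<partial>M)"
    by (rule nn_integral_cmult) measurable
  also have "(\<integral>\<^sup>+\<omega>. (\<integral>\<^sup>+u. ennreal ((1 - exp (- u * X \<omega>)) * u powr (- b - 1)) * indicator {0<..} u \<partial>lborel) \<partial>M)
      = (\<integral>\<^sup>+u. (\<integral>\<^sup>+\<omega>. ennreal ((1 - exp (- u * X \<omega>)) * u powr (- b - 1)) * indicator {0<..} u \<partial>M) \<partial>lborel)"
    by (rule lM.Fubini') measurable
  also have "\<dots> = (\<integral>\<^sup>+u\<in>{0<..}. ennreal ((1 - expectation (\<lambda>\<omega>. exp (- u * X \<omega>))) * u powr (- b - 1)) \<partial>lborel)"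
  proof (rule nn_integral_cong)
    fix u :: real
    show "(\<integral>\<^sup>+\<omega>. ennreal ((1 - exp (- u * X \<omega>)) * u powr (- b - 1)) * indicator {0<..} u \<partial>M)
      = ennreal ((1 - expectation (\<lambda>\<omega>. exp (- u * X \<omega>))) * u powr (- b - 1)) * indicator {0<..} u"
    proof (cases "u > 0")
      case True
      have int: "integrable M (\<lambda>\<omega>. exp (- u * X \<omega>))"
        using pos True by (intro integrable_const_bound[of _ 1] AE_I2) auto
      have "(\<integral>\<^sup>+\<omega>. ennreal ((1 - exp (- u * X \<omega>)) * u powr (- b - 1)) \<partial>M)
          = ennreal (expectation (\<lambda>\<omega>. (1 - exp (- u * X \<omega>)) * u powr (- b - 1)))"
        using int pos True by (intro nn_integral_eq_integral AE_I2) auto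
      also have "expectation (\<lambda>\<omega>. (1 - exp (- u * X \<omega>)) * u powr (- b - 1))
          = (1 - expectation (\<lambda>\<omega>. exp (- u * X \<omega>))) * u powr (- b - 1)"
        using int by (simp add: prob_space)
      finally show ?thesis using True by simp
    qed simp
  qed
  finally show ?thesis by (simp add: K_def)
qed

text \<open>With \<open>u = t\<^sup>-\<^sup>1\<^sup>/\<^sup>\<alpha>v\<close>, the mean of \<open>X(t)\<^sup>\<beta>\<close> becomes \<open>t\<^sup>\<beta>\<^sup>/\<^sup>\<alpha>\<close> times the integral of \<open>h t\<close> below. As
\<open>(1 + x/t)\<^sup>t \<le> exp x\<close>, with convergence for \<open>t \<rightarrow> \<infinity>\<close>, the limit \<open>hl\<close> of \<open>h t\<close> is itself an integrable
upper bound; this yields finiteness of the moment and, by dominated convergence, its asymptotics.\<close>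

lemma mittag_leffler_fractional_moment:
  fixes \<alpha> \<beta> \<rho> \<mu> :: real
  assumes X: "mittag_leffler_subordinator M \<alpha> \<rho> \<mu> X"
    and pars: "0 < \<alpha>" "\<alpha> < 1" "0 < \<rho>" "0 < \<mu>" "0 < \<beta>" "\<beta> < \<alpha>"
  shows "t > 0 \<Longrightarrow> integrable M (\<lambda>\<omega>. X t \<omega> powr \<beta>)"
    and "((\<lambda>t. expectation (\<lambda>\<omega>. X t \<omega> powr \<beta>) / t powr (\<beta> / \<alpha>)) \<longlongrightarrow>
           Gamma (1 - \<beta> / \<alpha>) / Gamma (1 - \<beta>) * (\<rho> / \<mu>) powr (\<beta> / \<alpha>)) at_top"
proof -
  have sub: "subordinator M X" using X by (simp add: mittag_leffler_subordinator_def)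
  note sp = subordinator_properties[OF sub]
  define \<phi> where "\<phi> t v = (\<mu> / (\<mu> + v powr \<alpha> / t)) powr (\<rho> * t)" for t v
  define h where "h t v = indicator {0<..} v * ((1 - \<phi> t v) * v powr (- \<beta> - 1))" for t v
  define hl where "hl v = indicator {0<..} v * ((1 - exp (- (\<rho> / \<mu>) * v powr \<alpha>)) * v powr (- \<beta> - 1))" for v
  define L where "L = Gamma (1 - \<beta> / \<alpha>) / \<beta> * (\<rho> / \<mu>) powr (\<beta> / \<alpha>)"
  define K where "K = \<beta> / Gamma (1 - \<beta>)"
  have G: "Gamma (1 - \<beta>) > 0" "Gamma (1 - \<beta> / \<alpha>) > 0"
    using pars by (auto intro!: Gamma_real_pos)
  have K: "K > 0" and L: "L > 0" using G pars by (simp_all add: K_def L_def)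
  have hm[measurable]: "h t \<in> borel_measurable borel" "hl \<in> borel_measurable borel" for t
    unfolding h_def[abs_def] hl_def[abs_def] \<phi>_def by measurable
  have \<phi>_eq: "\<phi> t v = ((1 + (v powr \<alpha> / \<mu>) / t) powr t) powr (- \<rho>)" if "t > 0" for t v
  proof -
    have "1 + (v powr \<alpha> / \<mu>) / t > 0" using pars that by (intro add_pos_nonneg) auto
    moreover have "\<mu> / (\<mu> + v powr \<alpha> / t) = inverse (1 + (v powr \<alpha> / \<mu>) / t)"
      using pars that by (simp add: field_simps)
    ultimately show ?thesis by (simp add: \<phi>_def powr_powr powr_minus inverse_powr mult.commute)
  qed
  have \<phi>_le: "\<phi> t v \<le> 1" and \<phi>_ge: "exp (- (\<rho> / \<mu>) * v powr \<alpha>) \<le> \<phi> t v" if t: "t > 0" for t v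
  proof -
    let ?x = "v powr \<alpha> / \<mu>"
    have x: "?x / t \<ge> 0" using pars t by simp
    have "1 powr t \<le> (1 + ?x / t) powr t" using x t by (intro powr_mono2) auto
    then have ge1: "(1 + ?x / t) powr t \<ge> 1" by simp
    have "y powr (- \<rho>) \<le> 1" if "y \<ge> 1" for y :: real
      using powr_mono[of "- \<rho>" 0 y] that pars by simp
    from this[OF ge1] show "\<phi> t v \<le> 1" unfolding \<phi>_eq[OF t] .
    have "(1 + ?x / t) powr t \<le> exp (?x / t) powr t"
      using x t exp_ge_add_one_self[of "?x / t"] by (intro powr_mono2) auto
    also have "\<dots> = exp ?x" using t by (simp add: powr_def)
    finally have "exp ?x powr (- \<rho>) \<le> ((1 + ?x / t) powr t) powr (- \<rho>)"
      using ge1 pars by (intro powr_mono2') auto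
    then show "exp (- (\<rho> / \<mu>) * v powr \<alpha>) \<le> \<phi> t v"
      unfolding \<phi>_eq[OF t] by (simp add: powr_def mult.commute)
  qed
  have h_bounds: "0 \<le> h t v" "h t v \<le> hl v" if "t > 0" for t v
    using \<phi>_le[OF that, of v] \<phi>_ge[OF that, of v]
    by (auto simp: h_def hl_def indicator_def intro!: mult_right_mono)
  have hl_nn: "(\<integral>\<^sup>+v. ennreal (hl v) \<partial>lborel) = ennreal L"
  proof -
    have "(\<integral>\<^sup>+v. ennreal (hl v) \<partial>lborel)
        = (\<integral>\<^sup>+v\<in>{0<..}. ennreal ((1 - exp (- (\<rho> / \<mu>) * v powr \<alpha>)) * v powr (- \<beta> - 1)) \<partial>lborel)"
      by (intro nn_integral_cong) (auto simp: hl_def indicator_def)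
    also have "\<dots> = ennreal L"
      unfolding L_def using pars by (intro nn_integral_one_minus_exp_powr) auto
    finally show ?thesis .
  qed
  have hl_nonneg: "hl v \<ge> 0" for v using h_bounds[of 1 v] by simp
  have hl_int: "integrable lborel hl"
    using hl_nn hl_nonneg by (intro integrableI_nonneg) auto
  have hl_val: "(\<integral>v. hl v \<partial>lborel) = L"
    using hl_nn hl_nonneg L by (subst integral_eq_nn_integral) auto
  have h_int: "integrable lborel (h t)" if "t > 0" for t
    by (rule Bochner_Integration.integrable_bound[OF hl_int]) (use h_bounds[OF that] hl_nonneg in auto)
  have moment: "(\<integral>\<^sup>+\<omega>. ennreal (X t \<omega> powr \<beta>) \<partial>M) = ennreal (K * (t powr (\<beta> / \<alpha>) * (\<integral>v. h t v \<partial>lborel)))"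
    if t: "t > 0" for t
  proof -
    \<comment> \<open>The scaling factor of the substitution \<open>u = cv\<close>.\<close>
    define c where "c = t powr (- (1 / \<alpha>))"
    have c: "c > 0" using t by (simp add: c_def)
    have LT: "expectation (\<lambda>\<omega>. exp (- u * X t \<omega>)) = (\<mu> / (\<mu> + u powr \<alpha>)) powr (\<rho> * t)" if "u \<ge> 0" for u
      using X t that by (auto simp: mittag_leffler_subordinator_def)
    define f where "f u = (1 - (\<mu> / (\<mu> + u powr \<alpha>)) powr (\<rho> * t)) * u powr (- \<beta> - 1)" for u
    have [measurable]: "f \<in> borel_measurable borel" unfolding f_def by measurable
    have "(\<integral>\<^sup>+\<omega>. ennreal (X t \<omega> powr \<beta>) \<partial>M) = ennreal K *
      (\<integral>\<^sup>+u\<in>{0<..}. ennreal ((1 - expectation (\<lambda>\<omega>. exp (- u * X t \<omega>))) * u powr (- \<beta> - 1)) \<partial>lborel)"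
      unfolding K_def using pars t sp by (intro nn_integral_powr_via_Laplace) auto
    also have "(\<integral>\<^sup>+u\<in>{0<..}. ennreal ((1 - expectation (\<lambda>\<omega>. exp (- u * X t \<omega>))) * u powr (- \<beta> - 1)) \<partial>lborel)
        = (\<integral>\<^sup>+u. ennreal (f u) * indicator {0<..} u \<partial>lborel)"
    proof (rule nn_integral_cong)
      fix u :: real
      show "ennreal ((1 - expectation (\<lambda>\<omega>. exp (- u * X t \<omega>))) * u powr (- \<beta> - 1)) * indicator {0<..} u
          = ennreal (f u) * indicator {0<..} u"
        using LT[of u] by (cases "u > 0") (simp_all add: f_def)
    qed
    also have "\<dots> = ennreal \<bar>c\<bar> * (\<integral>\<^sup>+v. ennreal (f (0 + c * v)) * indicator {0<..} (0 + c * v) \<partial>lborel)"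
      by (rule nn_integral_real_affine) (use c in auto)
    also have "\<dots> = (\<integral>\<^sup>+v. ennreal c * (ennreal (f (c * v)) * indicator {0<..} (c * v)) \<partial>lborel)"
      using c by (subst nn_integral_cmult) simp_all
    also have "\<dots> = (\<integral>\<^sup>+v. ennreal (t powr (\<beta> / \<alpha>)) * ennreal (h t v) \<partial>lborel)"
    proof (rule nn_integral_cong)
      fix v :: real
      show "ennreal c * (ennreal (f (c * v)) * indicator {0<..} (c * v)) = ennreal (t powr (\<beta> / \<alpha>)) * ennreal (h t v)"
      proof (cases "v > 0")
        case True
        have "c powr \<alpha> = 1 / t"
          using t pars powr_minus_divide[of t 1] unfolding c_def powr_powr by simp
        then have "(c * v) powr \<alpha> = v powr \<alpha> / t"
          using True c by (simp add: powr_mult)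
        then have f_eq: "f (c * v) = (1 - \<phi> t v) * (c powr (- \<beta> - 1) * v powr (- \<beta> - 1))"
          using True c by (simp add: f_def \<phi>_def powr_mult)
        have "c * c powr (- \<beta> - 1) = c powr (- \<beta>)"
          using c powr_add[of c 1 "- \<beta> - 1"] by simp
        also have "\<dots> = t powr (\<beta> / \<alpha>)" using pars by (simp add: c_def powr_powr)
        finally have "c * f (c * v) = t powr (\<beta> / \<alpha>) * ((1 - \<phi> t v) * v powr (- \<beta> - 1))"
          unfolding f_eq by (metis mult.assoc mult.left_commute)
        then show ?thesis using True c by (simp add: h_def ennreal_mult'[symmetric])
      next
        case False
        then show ?thesis using c by (simp add: h_def indicator_def zero_less_mult_iff)
      qed
    qed
    also have "\<dots> = ennreal (t powr (\<beta> / \<alpha>)) * ennreal (\<integral>v. h t v \<partial>lborel)"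
      using h_int[OF t] h_bounds(1)[OF t] by (subst nn_integral_cmult) (simp_all add: nn_integral_eq_integral)
    finally show ?thesis using K t by (simp add: ennreal_mult'[symmetric])
  qed
  show "integrable M (\<lambda>\<omega>. X t \<omega> powr \<beta>)" if "t > 0" for t
  proof (rule integrableI_nonneg)
    have [measurable]: "X t \<in> borel_measurable M" using sp(1)[of t] that by simp
    show "(\<lambda>\<omega>. X t \<omega> powr \<beta>) \<in> borel_measurable M" by measurable
    show "(\<integral>\<^sup>+\<omega>. ennreal (X t \<omega> powr \<beta>) \<partial>M) < \<infinity>" unfolding moment[OF that] by simp
  qed simp
  have E_eq: "expectation (\<lambda>\<omega>. X t \<omega> powr \<beta>) / t powr (\<beta> / \<alpha>) = K * (\<integral>v. h t v \<partial>lborel)" if t: "t > 0" for t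
  proof -
    have Xm[measurable]: "X t \<in> borel_measurable M" using sp(1)[of t] that by simp
    have "(\<integral>v. h t v \<partial>lborel) \<ge> 0" using h_bounds(1)[OF t] by simp
    then have "expectation (\<lambda>\<omega>. X t \<omega> powr \<beta>) = K * (t powr (\<beta> / \<alpha>) * (\<integral>v. h t v \<partial>lborel))"
      using K by (subst integral_eq_nn_integral) (simp_all add: moment[OF t])
    then show ?thesis using t by simp
  qed
  have "((\<lambda>t. \<integral>v. h t v \<partial>lborel) \<longlongrightarrow> (\<integral>v. hl v \<partial>lborel)) at_top"
  proof (rule integral_dominated_convergence_at_top[OF _ _ hl_int])
    show "\<forall>\<^sub>F t in at_top. AE v in lborel. norm (h t v) \<le> hl v"
      using eventually_gt_at_top[of 0] by eventually_elim (use h_bounds in auto)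
    show "AE v in lborel. ((\<lambda>t. h t v) \<longlongrightarrow> hl v) at_top"
    proof (rule AE_I2)
      fix v :: real
      have "((\<lambda>t. ((1 + (v powr \<alpha> / \<mu>) / t) powr t) powr (- \<rho>)) \<longlongrightarrow> exp (v powr \<alpha> / \<mu>) powr (- \<rho>)) at_top"
        by (intro tendsto_powr tendsto_exp_limit_at_top tendsto_const) simp
      moreover have "\<forall>\<^sub>F t in at_top. ((1 + (v powr \<alpha> / \<mu>) / t) powr t) powr (- \<rho>) = \<phi> t v"
        using eventually_gt_at_top[of 0] by eventually_elim (simp add: \<phi>_eq)
      ultimately have "((\<lambda>t. \<phi> t v) \<longlongrightarrow> exp (v powr \<alpha> / \<mu>) powr (- \<rho>)) at_top"
        by (rule Lim_transform_eventually)
      then have "((\<lambda>t. \<phi> t v) \<longlongrightarrow> exp (- (\<rho> / \<mu>) * v powr \<alpha>)) at_top"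
        by (simp add: powr_def mult.commute)
      then show "((\<lambda>t. h t v) \<longlongrightarrow> hl v) at_top"
        unfolding h_def hl_def by (intro tendsto_intros)
    qed
  qed simp_all
  then have "((\<lambda>t. K * (\<integral>v. h t v \<partial>lborel)) \<longlongrightarrow> K * L) at_top"
    unfolding hl_val by (rule tendsto_mult_left)
  moreover have "\<forall>\<^sub>F t in at_top. K * (\<integral>v. h t v \<partial>lborel) = expectation (\<lambda>\<omega>. X t \<omega> powr \<beta>) / t powr (\<beta> / \<alpha>)"
    using eventually_gt_at_top[of 0] by eventually_elim (simp add: E_eq)
  ultimately have "((\<lambda>t. expectation (\<lambda>\<omega>. X t \<omega> powr \<beta>) / t powr (\<beta> / \<alpha>)) \<longlongrightarrow> K * L) at_top"
    by (rule Lim_transform_eventually)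
  also have "K * L = Gamma (1 - \<beta> / \<alpha>) / Gamma (1 - \<beta>) * (\<rho> / \<mu>) powr (\<beta> / \<alpha>)"
    using pars G by (simp add: K_def L_def)
  finally show "((\<lambda>t. expectation (\<lambda>\<omega>. X t \<omega> powr \<beta>) / t powr (\<beta> / \<alpha>)) \<longlongrightarrow>
           Gamma (1 - \<beta> / \<alpha>) / Gamma (1 - \<beta>) * (\<rho> / \<mu>) powr (\<beta> / \<alpha>)) at_top" .
qed

end

section \<open>The generalized fractional negative binomial process\<close>

lemma ext_expectation_nonneg:
  assumes "\<And>\<omega>. \<omega> \<in> space P \<Longrightarrow> X \<omega> \<ge> 0"
  shows "ext_expectation P X = enn2ereal (\<integral>\<^sup>+\<omega>. ennreal (X \<omega>) \<partial>P)"
proof -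
  have "(\<integral>\<^sup>+\<omega>. ennreal (- X \<omega>) \<partial>P) = (\<integral>\<^sup>+\<omega>. 0 \<partial>P)"
    using assms by (intro nn_integral_cong) (simp add: ennreal_neg)
  then show ?thesis by (simp add: ext_expectation_def zero_ennreal.rep_eq)
qed

text \<open>The centred product differs from \<open>XY\<close> by an integrable function, and its negative part is
integrable. So if \<open>XY\<close> has infinite integral, both sides are \<open>\<infinity>\<close>, and otherwise the usual
computation applies.\<close>

lemma ext_covariance_nonneg:
  assumes P: "prob_space P" and X: "integrable P X" and Y: "integrable P Y"
    and pos: "\<And>\<omega>. X \<omega> \<ge> 0" "\<And>\<omega>. Y \<omega> \<ge> 0"
  shows "ext_covariance P X Y
    = enn2ereal (\<integral>\<^sup>+\<omega>. ennreal (X \<omega> * Y \<omega>) \<partial>P) - ereal (integral\<^sup>L P X * integral\<^sup>L P Y)"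
proof -
  interpret prob_space P by (rule P)
  let ?a = "integral\<^sup>L P X" and ?b = "integral\<^sup>L P Y"
  let ?Z = "\<lambda>\<omega>. (X \<omega> - ?a) * (Y \<omega> - ?b)"
  have [measurable]: "X \<in> borel_measurable P" "Y \<in> borel_measurable P" using X Y by auto
  have ab: "?a \<ge> 0" "?b \<ge> 0" using pos by auto
  show ?thesis
  proof (cases "(\<integral>\<^sup>+\<omega>. ennreal (X \<omega> * Y \<omega>) \<partial>P) = \<infinity>")
    case False
    have XY: "integrable P (\<lambda>\<omega>. X \<omega> * Y \<omega>)"
      using False pos by (intro integrableI_nonneg) (auto simp: less_top)
    have Z: "?Z = (\<lambda>\<omega>. X \<omega> * Y \<omega> - ?b * X \<omega> - ?a * Y \<omega> + ?a * ?b)"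
      by (auto simp: fun_eq_iff algebra_simps)
    have "integrable P ?Z" unfolding Z using XY X Y by auto
    moreover have "integral\<^sup>L P ?Z = (\<integral>\<omega>. X \<omega> * Y \<omega> \<partial>P) - ?a * ?b"
      unfolding Z using XY X Y by (simp add: prob_space algebra_simps)
    moreover have "enn2ereal (\<integral>\<^sup>+\<omega>. ennreal (X \<omega> * Y \<omega>) \<partial>P) = ereal (\<integral>\<omega>. X \<omega> * Y \<omega> \<partial>P)"
      using XY pos by (subst nn_integral_eq_integral) auto
    ultimately show ?thesis unfolding ext_covariance_def by (simp add: ext_expectation_integrable)
  next
    case True
    have neg: "(\<integral>\<^sup>+\<omega>. ennreal (- ?Z \<omega>) \<partial>P) < \<infinity>"
      by (rule ext_covariance_well_defined) (use assms in auto)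
    have lin: "integrable P (\<lambda>\<omega>. ?b * X \<omega> + ?a * Y \<omega>)" using X Y by auto
    have "(\<integral>\<^sup>+\<omega>. ennreal (X \<omega> * Y \<omega>) \<partial>P)
        \<le> (\<integral>\<^sup>+\<omega>. ennreal (?Z \<omega>) + ennreal (?b * X \<omega> + ?a * Y \<omega>) \<partial>P)"
    proof (rule nn_integral_mono)
      fix \<omega>
      have "X \<omega> * Y \<omega> = ?Z \<omega> + (?b * X \<omega> + ?a * Y \<omega>) - ?a * ?b" by (simp add: algebra_simps)
      then have "X \<omega> * Y \<omega> \<le> max 0 (?Z \<omega>) + (?b * X \<omega> + ?a * Y \<omega>)"
        using mult_nonneg_nonneg[OF ab] max.cobounded2[of "?Z \<omega>" 0] by linarith
      then have "ennreal (X \<omega> * Y \<omega>) \<le> ennreal (max 0 (?Z \<omega>) + (?b * X \<omega> + ?a * Y \<omega>))"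
        by (rule ennreal_leI)
      also have "\<dots> = ennreal (max 0 (?Z \<omega>)) + ennreal (?b * X \<omega> + ?a * Y \<omega>)"
        using ab pos by (intro ennreal_plus) auto
      finally show "ennreal (X \<omega> * Y \<omega>) \<le> ennreal (?Z \<omega>) + ennreal (?b * X \<omega> + ?a * Y \<omega>)"
        by (simp add: ennreal_max_0)
    qed
    also have "\<dots> = (\<integral>\<^sup>+\<omega>. ennreal (?Z \<omega>) \<partial>P) + (\<integral>\<^sup>+\<omega>. ennreal (?b * X \<omega> + ?a * Y \<omega>) \<partial>P)"
      by (rule nn_integral_add) measurable
    finally have "(\<integral>\<^sup>+\<omega>. ennreal (?Z \<omega>) \<partial>P) + (\<integral>\<^sup>+\<omega>. ennreal (?b * X \<omega> + ?a * Y \<omega>) \<partial>P) = \<infinity>"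
      using True by (simp add: top_unique)
    moreover have "(\<integral>\<^sup>+\<omega>. ennreal (?b * X \<omega> + ?a * Y \<omega>) \<partial>P) < \<infinity>"
      using lin by (auto simp: real_integrable_def top.not_eq_extremum)
    ultimately have "(\<integral>\<^sup>+\<omega>. ennreal (?Z \<omega>) \<partial>P) = \<infinity>"
      by (auto simp: ennreal_add_eq_top)
    then show ?thesis
      using True neg unfolding ext_covariance_def ext_expectation_def
      by (cases "\<integral>\<^sup>+\<omega>. ennreal (- ?Z \<omega>) \<partial>P") (simp_all add: top_ennreal.rep_eq)
  qed
qed

text \<open>The time change by \<open>X\<close> is frozen, and the moments of the fractional Poisson process at the frozen
times are averaged. Measurability of the composition comes from right-continuity. The second moments
may be infinite, whence \<open>ennreal\<close>.\<close>

lemma (in prob_space) gfnbp_moments: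
  fixes lam \<beta> :: real
  assumes N: "poisson_process M lam N" and S: "stable_subordinator M \<beta> S" and X: "subordinator M X"
    and indN: "independent_processes M (\<lambda>t \<omega>. real (N t \<omega>)) (inverse_process S)"
    and indX: "independent_processes M X (\<lambda>t \<omega>. real (fractional_poisson N S t \<omega>))"
    and \<beta>: "\<beta> > 0" and lam: "lam > 0" and st: "0 \<le> s" "s \<le> t"
  defines "q \<equiv> lam / Gamma (1 + \<beta>)"
  shows "(\<lambda>\<omega>. real (gfnbp N S X s \<omega>)) \<in> borel_measurable M"
    and "(\<integral>\<^sup>+\<omega>. ennreal (real (gfnbp N S X s \<omega>)) \<partial>M) = ennreal q * (\<integral>\<^sup>+\<omega>. ennreal (X s \<omega> powr \<beta>) \<partial>M)"
    and "(\<integral>\<^sup>+\<omega>. ennreal (real (gfnbp N S X s \<omega>) * real (gfnbp N S X t \<omega>)) \<partial>M)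
      = ennreal q * (\<integral>\<^sup>+\<omega>. ennreal (X s \<omega> powr \<beta>) \<partial>M)
      + ennreal (\<beta> * q\<^sup>2 * Beta \<beta> (1 + \<beta>)) * (\<integral>\<^sup>+\<omega>. ennreal (X s \<omega> powr (2 * \<beta>)) \<partial>M)
      + ennreal (q\<^sup>2 * \<beta>) * (\<integral>\<^sup>+\<omega>. ennreal (X t \<omega> powr (2 * \<beta>) * incomplete_Beta \<beta> (1 + \<beta>) (X s \<omega> / X t \<omega>)) \<partial>M)"
proof -
  define Y where "Y r \<omega> = real (fractional_poisson N S r \<omega>)" for r \<omega>
  note sp = subordinator_properties[OF X]
  have t: "t \<ge> 0" using st by simp
  have G: "real (gfnbp N S X r \<omega>) = Y (X r \<omega>) \<omega>" for r \<omega> by (simp add: gfnbp_def Y_def)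
  have ind: "independent_processes M X Y" using indX by (simp add: Y_def[abs_def])
  have Y_rc: "((\<lambda>r. Y r \<omega>) \<longlongrightarrow> Y u \<omega>) (at_right u)" if "\<omega> \<in> space M" "u \<ge> 0" for \<omega> u
    unfolding Y_def using N that by (intro fractional_poisson_right_continuous) (auto simp: poisson_process_def)
  have q: "q > 0" using lam \<beta> Gamma_real_pos[of "1 + \<beta>"] by (simp add: q_def)
  have Beta: "Beta \<beta> (1 + \<beta>) \<ge> 0"
    using \<beta> Beta_nonneg[of \<beta> "1 + \<beta>"] by simp
  have Xm[measurable]: "X s \<in> borel_measurable M" "X t \<in> borel_measurable M" using sp(1) st t by auto
  have "(\<lambda>\<omega>. path_at (\<lambda>r. Y r \<omega>) (X s \<omega>)) \<in> borel_measurable M"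
    by (rule measurable_process_at_random_time[of Y M "\<lambda>\<omega>. \<omega>"])
       (use independent_processes_measurable(2)[OF ind] in auto)
  then show "(\<lambda>\<omega>. real (gfnbp N S X s \<omega>)) \<in> borel_measurable M"
    unfolding G
    by (rule measurable_cong[THEN iffD1, rotated]) (use st in \<open>simp add: path_at_eq Y_rc sp(4)\<close>)
  have pos: "AE \<omega> in M. X s \<omega> \<ge> 0" "AE \<omega> in M. X t \<omega> \<ge> 0" using sp(4) st t by auto
  note comp = nn_integral_independent_composition[OF ind Y_rc]
  note mom = fractional_poisson_moments[OF N S indN \<beta> lam, folded q_def Y_def]
  have "(\<integral>\<^sup>+\<omega>. ennreal (real (gfnbp N S X s \<omega>)) \<partial>M) = (\<integral>\<^sup>+\<omega>. \<integral>\<^sup>+\<omega>'. ennreal (Y (X s \<omega>) \<omega>') \<partial>M \<partial>M)"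
    unfolding G using comp[OF _ _ st(1) st(1) pos(1) pos(1), of "\<lambda>z. ennreal (fst z)"] by simp
  also have "\<dots> = (\<integral>\<^sup>+\<omega>. ennreal q * ennreal (X s \<omega> powr \<beta>) \<partial>M)"
    by (rule nn_integral_cong) (use q st in \<open>simp add: mom(1)[OF _ order_refl] sp(4) ennreal_mult'\<close>)
  also have "\<dots> = ennreal q * (\<integral>\<^sup>+\<omega>. ennreal (X s \<omega> powr \<beta>) \<partial>M)"
    by (rule nn_integral_cmult) measurable
  finally show "(\<integral>\<^sup>+\<omega>. ennreal (real (gfnbp N S X s \<omega>)) \<partial>M) = ennreal q * (\<integral>\<^sup>+\<omega>. ennreal (X s \<omega> powr \<beta>) \<partial>M)" .
  have "(\<integral>\<^sup>+\<omega>. ennreal (real (gfnbp N S X s \<omega>) * real (gfnbp N S X t \<omega>)) \<partial>M)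
      = (\<integral>\<^sup>+\<omega>. \<integral>\<^sup>+\<omega>'. ennreal (Y (X s \<omega>) \<omega>' * Y (X t \<omega>) \<omega>') \<partial>M \<partial>M)"
    unfolding G using comp[OF _ _ st(1) t pos, of "\<lambda>z. ennreal (fst z * snd z)"] by simp
  also have "\<dots> = (\<integral>\<^sup>+\<omega>. ennreal q * ennreal (X s \<omega> powr \<beta>)
      + ennreal (\<beta> * q\<^sup>2 * Beta \<beta> (1 + \<beta>)) * ennreal (X s \<omega> powr (2 * \<beta>))
      + ennreal (q\<^sup>2 * \<beta>) * ennreal (X t \<omega> powr (2 * \<beta>) * incomplete_Beta \<beta> (1 + \<beta>) (X s \<omega> / X t \<omega>)) \<partial>M)"
  proof (rule nn_integral_cong)
    fix \<omega> assume \<omega>: "\<omega> \<in> space M"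
    let ?A = "q * X s \<omega> powr \<beta>" and ?B = "\<beta> * q\<^sup>2 * Beta \<beta> (1 + \<beta>) * X s \<omega> powr (2 * \<beta>)"
      and ?C = "q\<^sup>2 * \<beta> * (X t \<omega> powr (2 * \<beta>) * incomplete_Beta \<beta> (1 + \<beta>) (X s \<omega> / X t \<omega>))"
    have nn: "?A \<ge> 0" "?B \<ge> 0" "?C \<ge> 0"
      using q \<beta> Beta incomplete_Beta_nonneg[of \<beta> "1 + \<beta>" "X s \<omega> / X t \<omega>"]
      by (auto intro!: mult_nonneg_nonneg)
    have "(\<integral>\<^sup>+\<omega>'. ennreal (Y (X s \<omega>) \<omega>' * Y (X t \<omega>) \<omega>') \<partial>M) = ennreal (?A + ?B + ?C)"
      using mom(2)[OF sp(4)[OF \<omega> st(1)] sp(3)[OF \<omega> st]] by (simp add: algebra_simps)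
    also have "\<dots> = ennreal ?A + ennreal ?B + ennreal ?C" using nn by simp
    finally show "(\<integral>\<^sup>+\<omega>'. ennreal (Y (X s \<omega>) \<omega>' * Y (X t \<omega>) \<omega>') \<partial>M)
      = ennreal q * ennreal (X s \<omega> powr \<beta>)
      + ennreal (\<beta> * q\<^sup>2 * Beta \<beta> (1 + \<beta>)) * ennreal (X s \<omega> powr (2 * \<beta>))
      + ennreal (q\<^sup>2 * \<beta>) * ennreal (X t \<omega> powr (2 * \<beta>) * incomplete_Beta \<beta> (1 + \<beta>) (X s \<omega> / X t \<omega>))"
      using q \<beta> Beta by (simp only: ennreal_mult' zero_le_power2 mult_nonneg_nonneg less_imp_le)
  qed
  also have "\<dots> = ennreal q * (\<integral>\<^sup>+\<omega>. ennreal (X s \<omega> powr \<beta>) \<partial>M)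
      + ennreal (\<beta> * q\<^sup>2 * Beta \<beta> (1 + \<beta>)) * (\<integral>\<^sup>+\<omega>. ennreal (X s \<omega> powr (2 * \<beta>)) \<partial>M)
      + ennreal (q\<^sup>2 * \<beta>) * (\<integral>\<^sup>+\<omega>. ennreal (X t \<omega> powr (2 * \<beta>) * incomplete_Beta \<beta> (1 + \<beta>) (X s \<omega> / X t \<omega>)) \<partial>M)"
    by (subst nn_integral_add, measurable)+ (subst nn_integral_cmult, measurable)+
  finally show "(\<integral>\<^sup>+\<omega>. ennreal (real (gfnbp N S X s \<omega>) * real (gfnbp N S X t \<omega>)) \<partial>M)
      = ennreal q * (\<integral>\<^sup>+\<omega>. ennreal (X s \<omega> powr \<beta>) \<partial>M)
      + ennreal (\<beta> * q\<^sup>2 * Beta \<beta> (1 + \<beta>)) * (\<integral>\<^sup>+\<omega>. ennreal (X s \<omega> powr (2 * \<beta>)) \<partial>M)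
      + ennreal (q\<^sup>2 * \<beta>) * (\<integral>\<^sup>+\<omega>. ennreal (X t \<omega> powr (2 * \<beta>) * incomplete_Beta \<beta> (1 + \<beta>) (X s \<omega> / X t \<omega>)) \<partial>M)" .
qed

text \<open>The mean and the covariance come from the preceding moments; the variance is the covariance at
\<open>s = t\<close>, where the incomplete beta function is complete. The comparison of \<open>E[G(t)]\<close> with its
asymptotic form is that of \<open>E[M(t)\<^sup>\<beta>]\<close>, multiplied by \<open>q\<close>.\<close>

theorem theorem3p1:
  fixes P :: "'a measure"
    and N :: "real \<Rightarrow> 'a \<Rightarrow> nat"
    and S M :: "real \<Rightarrow> 'a \<Rightarrow> real"
    and \<alpha> \<beta> \<rho> \<mu> lam q d :: real
  assumes "prob_space P"
    and "0 < \<alpha>" "\<alpha> < 1" "0 < \<rho>" "0 < \<mu>" "0 < lam" "0 < \<beta>" "\<beta> < \<alpha>"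
    and "poisson_process P lam N"
    and "stable_subordinator P \<beta> S"
    and "mittag_leffler_subordinator P \<alpha> \<rho> \<mu> M"
    and "independent_processes P (\<lambda>t \<omega>. real (N t \<omega>)) (inverse_process S)"
    and "independent_processes P M (\<lambda>t \<omega>. real (fractional_poisson N S t \<omega>))"
    and q: "q = lam / Gamma (1 + \<beta>)"
    and d: "d = \<beta> * q\<^sup>2 * Beta \<beta> (1 + \<beta>)"
  defines "G \<equiv> (\<lambda>t \<omega>. real (gfnbp N S M t \<omega>))"
    and "E \<equiv> prob_space.expectation P"
  shows
    "(\<forall>t>0. integrable P (G t) \<and> integrable P (\<lambda>\<omega>. M t \<omega> powr \<beta>) \<and>
        E (G t) = q * E (\<lambda>\<omega>. M t \<omega> powr \<beta>))
     \<and> (\<lambda>t. E (G t)) \<sim>[at_top]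
         (\<lambda>t. q * Gamma (1 - \<beta> / \<alpha>) / (\<mu> powr (\<beta> / \<alpha>) * Gamma (1 - \<beta>)) * (\<rho> * t) powr (\<beta> / \<alpha>))
     \<and> (\<forall>t>0. ext_variance P (G t) =
         ereal (q * E (\<lambda>\<omega>. M t \<omega> powr \<beta>)) - ereal (q\<^sup>2 * (E (\<lambda>\<omega>. M t \<omega> powr \<beta>))\<^sup>2)
         + ereal (2 * d) * ext_expectation P (\<lambda>\<omega>. M t \<omega> powr (2 * \<beta>)))
     \<and> (\<forall>s t. 0 < s \<and> s \<le> t \<longrightarrow> ext_covariance P (G s) (G t) =
         ereal (q * E (\<lambda>\<omega>. M s \<omega> powr \<beta>))
         + ereal d * ext_expectation P (\<lambda>\<omega>. M s \<omega> powr (2 * \<beta>))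
         - ereal (q\<^sup>2 * E (\<lambda>\<omega>. M s \<omega> powr \<beta>) * E (\<lambda>\<omega>. M t \<omega> powr \<beta>))
         + ereal (q\<^sup>2 * \<beta>) * ext_expectation P
             (\<lambda>\<omega>. M t \<omega> powr (2 * \<beta>) * incomplete_Beta \<beta> (1 + \<beta>) (M s \<omega> / M t \<omega>)))"
proof -
  interpret prob_space P by fact
  note pars = assms(2-8)
  note mlM = assms(11)
  have subM: "subordinator P M" using mlM by (simp add: mittag_leffler_subordinator_def)
  note spM = subordinator_properties[OF subM]
  note mom = gfnbp_moments[OF assms(9,10) subM assms(12,13) \<open>0 < \<beta>\<close> \<open>0 < lam\<close>, folded q]
  note frac = mittag_leffler_fractional_moment[OF mlM pars(1-4,6,7)]
  have qpos: "q > 0" using pars Gamma_real_pos[of "1 + \<beta>"] by (simp add: q)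
  have dnn: "d \<ge> 0"
    using pars Beta_nonneg[of \<beta> "1 + \<beta>"] by (simp add: d)
  have G_nonneg: "G t \<omega> \<ge> 0" for t \<omega> by (simp add: G_def)
  have M_nn: "(\<integral>\<^sup>+\<omega>. ennreal (M t \<omega> powr \<beta>) \<partial>P) = ennreal (E (\<lambda>\<omega>. M t \<omega> powr \<beta>))" if "t > 0" for t
    unfolding E_def by (rule nn_integral_eq_integral[OF frac(1)[OF that]]) simp
  have EM: "E (\<lambda>\<omega>. M t \<omega> powr \<beta>) \<ge> 0" for t by (simp add: E_def)
  have G_nn: "(\<integral>\<^sup>+\<omega>. ennreal (G t \<omega>) \<partial>P) = ennreal (q * E (\<lambda>\<omega>. M t \<omega> powr \<beta>))" if "t > 0" for t
    using mom(2)[of t t] that qpos by (simp add: G_def M_nn ennreal_mult')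
  have G_meas: "G t \<in> borel_measurable P" if "t > 0" for t
    using mom(1)[of t t] that by (simp add: G_def)
  have G_int: "integrable P (G t)" if "t > 0" for t
    using G_meas[OF that] G_nn[OF that] G_nonneg by (intro integrableI_nonneg) auto
  have G_exp: "E (G t) = q * E (\<lambda>\<omega>. M t \<omega> powr \<beta>)" if "t > 0" for t
    unfolding E_def
    using G_meas[OF that] G_nn[OF that] G_nonneg qpos EM[of t]
    by (subst integral_eq_nn_integral) (auto simp: E_def)
  have cov: "ext_covariance P (G s) (G t) =
         ereal (q * E (\<lambda>\<omega>. M s \<omega> powr \<beta>))
         + ereal d * ext_expectation P (\<lambda>\<omega>. M s \<omega> powr (2 * \<beta>))
         - ereal (q\<^sup>2 * E (\<lambda>\<omega>. M s \<omega> powr \<beta>) * E (\<lambda>\<omega>. M t \<omega> powr \<beta>))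
         + ereal (q\<^sup>2 * \<beta>) * ext_expectation P
             (\<lambda>\<omega>. M t \<omega> powr (2 * \<beta>) * incomplete_Beta \<beta> (1 + \<beta>) (M s \<omega> / M t \<omega>))"
    if st: "0 < s" "s \<le> t" for s t
  proof -
    define B where "B = ereal d * ext_expectation P (\<lambda>\<omega>. M s \<omega> powr (2 * \<beta>))"
    define C where "C = ereal (q\<^sup>2 * \<beta>) * ext_expectation P
             (\<lambda>\<omega>. M t \<omega> powr (2 * \<beta>) * incomplete_Beta \<beta> (1 + \<beta>) (M s \<omega> / M t \<omega>))"
    have t: "t > 0" using st by simp
    have B: "B = enn2ereal (ennreal d * (\<integral>\<^sup>+\<omega>. ennreal (M s \<omega> powr (2 * \<beta>)) \<partial>P))"
      unfolding B_def using dnn by (simp add: ext_expectation_nonneg times_ennreal.rep_eq)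
    have C: "C = enn2ereal (ennreal (q\<^sup>2 * \<beta>) *
        (\<integral>\<^sup>+\<omega>. ennreal (M t \<omega> powr (2 * \<beta>) * incomplete_Beta \<beta> (1 + \<beta>) (M s \<omega> / M t \<omega>)) \<partial>P))"
      unfolding C_def using pars
      by (subst ext_expectation_nonneg) (simp_all add: times_ennreal.rep_eq incomplete_Beta_nonneg)
    have "enn2ereal (\<integral>\<^sup>+\<omega>. ennreal (G s \<omega> * G t \<omega>) \<partial>P) = ereal (q * E (\<lambda>\<omega>. M s \<omega> powr \<beta>)) + B + C"
      unfolding B C using mom(3)[of s t] st qpos EM[of s]
      by (simp add: G_def d M_nn plus_ennreal.rep_eq ennreal_mult'[symmetric])
    then have "ext_covariance P (G s) (G t) = ereal (q * E (\<lambda>\<omega>. M s \<omega> powr \<beta>)) + B + C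
        - ereal (q\<^sup>2 * E (\<lambda>\<omega>. M s \<omega> powr \<beta>) * E (\<lambda>\<omega>. M t \<omega> powr \<beta>))"
      using ext_covariance_nonneg[OF assms(1) G_int[OF st(1)] G_int[OF t] G_nonneg G_nonneg]
        G_exp[OF st(1)] G_exp[OF t]
      by (simp add: E_def power2_eq_square mult_ac)
    \<comment> \<open>Nonnegativity excludes \<open>-\<infinity>\<close>, so that the finite term may be subtracted in either order.\<close>
    moreover have "B \<ge> 0" "C \<ge> 0" unfolding B C by simp_all
    ultimately show ?thesis
      unfolding B_def[symmetric] C_def[symmetric] by (cases B; cases C) simp_all
  qed
  have var: "ext_variance P (G t) =
         ereal (q * E (\<lambda>\<omega>. M t \<omega> powr \<beta>)) - ereal (q\<^sup>2 * (E (\<lambda>\<omega>. M t \<omega> powr \<beta>))\<^sup>2)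
         + ereal (2 * d) * ext_expectation P (\<lambda>\<omega>. M t \<omega> powr (2 * \<beta>))" if t: "t > 0" for t
  proof -
    define X where "X = ext_expectation P (\<lambda>\<omega>. M t \<omega> powr (2 * \<beta>))"
    have X: "X = enn2ereal (\<integral>\<^sup>+\<omega>. ennreal (M t \<omega> powr (2 * \<beta>)) \<partial>P)"
      by (simp add: X_def ext_expectation_nonneg)
    \<comment> \<open>If \<open>M t \<omega> = 0\<close>, then the quotient is \<open>0 / 0 = 0\<close>, but the factor \<open>0 powr (2 * \<beta>)\<close> vanishes.\<close>
    have "M t \<omega> powr (2 * \<beta>) * incomplete_Beta \<beta> (1 + \<beta>) (M t \<omega> / M t \<omega>)
        = Beta \<beta> (1 + \<beta>) * M t \<omega> powr (2 * \<beta>)" for \<omega>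
      using pars by (cases "M t \<omega> = 0") (simp_all add: incomplete_Beta_one)
    moreover have "ext_expectation P (\<lambda>\<omega>. Beta \<beta> (1 + \<beta>) * M t \<omega> powr (2 * \<beta>)) = ereal (Beta \<beta> (1 + \<beta>)) * X"
    proof -
      have [measurable]: "M t \<in> borel_measurable P" using spM(1) t by simp
      have "Beta \<beta> (1 + \<beta>) \<ge> 0"
        using pars Beta_nonneg[of \<beta> "1 + \<beta>"] by simp
      then show ?thesis
        by (simp add: X ext_expectation_nonneg ennreal_mult' nn_integral_cmult times_ennreal.rep_eq)
    qed
    ultimately have "ext_covariance P (G t) (G t) =
        ereal (q * E (\<lambda>\<omega>. M t \<omega> powr \<beta>)) + ereal d * X
         - ereal (q\<^sup>2 * E (\<lambda>\<omega>. M t \<omega> powr \<beta>) * E (\<lambda>\<omega>. M t \<omega> powr \<beta>))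
         + ereal (q\<^sup>2 * \<beta>) * (ereal (Beta \<beta> (1 + \<beta>)) * X)"
      using cov[OF t order_refl] by (simp only: X_def)
    also have "ereal (q\<^sup>2 * \<beta>) * (ereal (Beta \<beta> (1 + \<beta>)) * X) = ereal d * X"
      by (simp only: mult.assoc[of "ereal _", symmetric] times_ereal.simps d mult.commute[of "q\<^sup>2" \<beta>])
    finally have c: "ext_covariance P (G t) (G t) =
        ereal (q * E (\<lambda>\<omega>. M t \<omega> powr \<beta>)) + ereal d * X
         - ereal (q\<^sup>2 * E (\<lambda>\<omega>. M t \<omega> powr \<beta>) * E (\<lambda>\<omega>. M t \<omega> powr \<beta>)) + ereal d * X" .
    have "X \<ge> 0" unfolding X by simp
    then show ?thesis
      unfolding ext_variance_def X_def[symmetric]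
      using c dnn unfolding ext_covariance_def power2_eq_square
      by (cases X; cases "d = 0") (simp_all add: algebra_simps)
  qed
  have asymp: "(\<lambda>t. E (G t)) \<sim>[at_top]
         (\<lambda>t. q * Gamma (1 - \<beta> / \<alpha>) / (\<mu> powr (\<beta> / \<alpha>) * Gamma (1 - \<beta>)) * (\<rho> * t) powr (\<beta> / \<alpha>))"
  proof (rule asymp_equivI')
    define c where "c = Gamma (1 - \<beta> / \<alpha>) / Gamma (1 - \<beta>) * (\<rho> / \<mu>) powr (\<beta> / \<alpha>)"
    have "Gamma (1 - \<beta>) > 0" "Gamma (1 - \<beta> / \<alpha>) > 0" using pars by (auto intro!: Gamma_real_pos)
    then have c: "c > 0" using pars by (simp add: c_def)
    have "((\<lambda>t. expectation (\<lambda>\<omega>. M t \<omega> powr \<beta>) / t powr (\<beta> / \<alpha>) / c) \<longlongrightarrow> c / c) at_top"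
      using frac(2) c unfolding c_def[symmetric] by (intro tendsto_divide tendsto_const) auto
    moreover have "\<forall>\<^sub>F t in at_top. expectation (\<lambda>\<omega>. M t \<omega> powr \<beta>) / t powr (\<beta> / \<alpha>) / c
       = E (G t) / (q * Gamma (1 - \<beta> / \<alpha>) / (\<mu> powr (\<beta> / \<alpha>) * Gamma (1 - \<beta>)) * (\<rho> * t) powr (\<beta> / \<alpha>))"
      using eventually_gt_at_top[of 0]
    proof eventually_elim
      case (elim t)
      have "q * Gamma (1 - \<beta> / \<alpha>) / (\<mu> powr (\<beta> / \<alpha>) * Gamma (1 - \<beta>)) * (\<rho> * t) powr (\<beta> / \<alpha>)
          = q * (t powr (\<beta> / \<alpha>) * c)"
        using pars elim by (simp add: c_def powr_mult powr_divide mult_ac)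
      then show ?case using G_exp[OF elim] qpos by (simp add: E_def)
    qed
    ultimately have "((\<lambda>t. E (G t) / (q * Gamma (1 - \<beta> / \<alpha>) / (\<mu> powr (\<beta> / \<alpha>) * Gamma (1 - \<beta>))
        * (\<rho> * t) powr (\<beta> / \<alpha>))) \<longlongrightarrow> c / c) at_top"
      by (rule Lim_transform_eventually)
    then show "((\<lambda>t. E (G t) / (q * Gamma (1 - \<beta> / \<alpha>) / (\<mu> powr (\<beta> / \<alpha>) * Gamma (1 - \<beta>))
        * (\<rho> * t) powr (\<beta> / \<alpha>))) \<longlongrightarrow> 1) at_top"
      using c by simp
  qed
  show ?thesis using G_int frac(1) G_exp asymp var cov by blast
qed

end
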